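(* Let $\mathcal{G}$ and $\mathcal{H}$ be ample Hausdorff groupoids. Let $R$ and $S$ be two indecomposable (commutative, unital) rings such that $(\mathcal{G},R)$ and $(\mathcal{H},S)$ satisfy the local bisection hypothesis. Let $T\colon A_R(\mathcal{G})\to A_S(\mathcal{H})$ be a diagonal-preserving ring isomorphism, that is, $T(D_R(\mathcal{G}))=D_S(\mathcal{H})$. Then there exist a unique topological groupoid isomorphism $\phi\colon\mathcal{H}\to\mathcal{G}$ and a continuous cocycle $\chi\colon\mathcal{H}\to\operatorname{Iso}_+(R,S)$ such that $$Tf(a)=\chi(a)\big(f(\phi(a))\big)\qquad\text{for all } a\in\mathcal{H}\text{ and } f\in A_R(\mathcal{G}).$$
   Context: A groupoid $\mathcal{G}$ is a small category with inverses; a topological groupoid carries a topology making product and inversion continuous. Put $\mathfrak{s}(a)=a^{-1}a$, $\mathfrak{r}(a)=aa^{-1}$, $\mathcal{G}^{(0)}=\mathfrak{s}(\mathcal{G})$, and $\mathcal{G}^{(2)}=\{(a,b):\mathfrak{s}(a)=\mathfrak{r}(b)\}$ (composable pairs). $\mathcal{G}$ is étale if $\mathfrak{r}\colon\mathcal{G}\to\mathcal{G}^{(0)}$ is a local homeomorphism, and ample if it is locally compact, zero-dimensional and étale. A bisection is a subset $A\subseteq\mathcal{G}$ on which $\mathfrak{s}$ and $\mathfrak{r}$ are injective. A topological groupoid isomorphism is a groupoid isomorphism which is a homeomorphism. A nontrivial commutative unital ring is indecomposable if its only idempotents are $0$ and $1$. For an ample Hausdorff groupoid $\mathcal{G}$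 and a commutative unital ring $R$, the Steinberg algebra $A_R(\mathcal{G})$ is the $R$-linear span of the characteristic functions $1_U\colon\mathcal{G}\to R$ of compact-open bisections $U$ of $\mathcal{G}$ (equivalently, the set of locally constant compactly supported functions $\mathcal{G}\to R$), with pointwise addition and convolution product $(fg)(a)=\sum_{cd=a}f(c)g(d)$. The diagonal subalgebra is $D_R(\mathcal{G})=\{f\in A_R(\mathcal{G}):\operatorname{supp}(f)\subseteq\mathcal{G}^{(0)}\}$, where $\operatorname{supp}(f)=\overline{[f\neq 0]}=[f\neq0]$. A normalizer of $D_R(\mathcal{G})$ is an $f\in A_R(\mathcal{G})$ for which there is $g\in A_R(\mathcal{G})$ with $fD_R(\mathcal{G})g\subseteq D_R(\mathcal{G})$, $gD_R(\mathcal{G})f\subseteq D_R(\mathcal{G})$, $fgf=f$ and $gfg=g$. The pair $(\mathcal{G},R)$ satisfies the local bisection hypothesis if $\operatorname{supp}(f)$ is a bisection for every normalizer $f$ of $D_R(\mathcal{G})$. $\operatorname{Iso}_+(R,S)$ is the set of isomorphisms of additive groups from $R$ to $S$, with the topology of pointwise convergence ($R,S$ discrete): a map $\chi$ from a topological space to $\operatorname{Iso}_+(R,S)$ is continuous iff for each $r\in R$ the map $x\mapsto\chi(x)(r)\in S$ is locally constant. A cocycle is a map $\chi\colon\mathcal{H}\to\operatorname{Iso}_+(R,S)$ with $\chi(ab)(rs)=\chi(a)(r)\chi(b)(s)$ for all $(a,b)\in\mathcal{H}^{(2)}$ and $r,s\in R$. *)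

theory Defs
  imports "HOL-Analysis.Analysis" "HOL-Library.Function_Algebras"
begin

text \<open>
  Groupoids are given by their arrows, objects being identified with identity arrows.
  The carrier is the underlying set of the topology; \<open>gmult\<close> and \<open>ginv\<close> are only
  meaningful on composable pairs and on the carrier, respectively.
\<close>

record 'a groupoid =
  gtop :: "'a topology"
  gmult :: "'a \<Rightarrow> 'a \<Rightarrow> 'a"
  ginv :: "'a \<Rightarrow> 'a"

definition arrows :: "'a groupoid \<Rightarrow> 'a set" where
  "arrows G = topspace (gtop G)"

definition src :: "'a groupoid \<Rightarrow> 'a \<Rightarrow> 'a" where
  "src G a = gmult G (ginv G a) a"

definition rng :: "'a groupoid \<Rightarrow> 'a \<Rightarrow> 'a" where
  "rng G a = gmult G a (ginv G a)"

definition units :: "'a groupoid \<Rightarrow> 'a set" where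
  "units G = src G ` arrows G"

definition composable :: "'a groupoid \<Rightarrow> ('a \<times> 'a) set" where
  "composable G = {(a, b). a \<in> arrows G \<and> b \<in> arrows G \<and> src G a = rng G b}"

text \<open>
  The axioms of a category with source \<open>src\<close>, range \<open>rng\<close> and identities \<open>units G\<close>, in
  which \<open>ginv G a\<close> is the inverse of \<open>a\<close> (by definition of \<open>src\<close> and \<open>rng\<close>).
\<close>

locale groupoid =
  fixes G :: "'a groupoid"
  assumes inv_closed: "a \<in> arrows G \<Longrightarrow> ginv G a \<in> arrows G"
    and inv_inv: "a \<in> arrows G \<Longrightarrow> ginv G (ginv G a) = a"
    and mult_closed: "(a, b) \<in> composable G \<Longrightarrow> gmult G a b \<in> arrows G"
    and src_mult: "(a, b) \<in> composable G \<Longrightarrow> src G (gmult G a b) = src G b"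
    and rng_mult: "(a, b) \<in> composable G \<Longrightarrow> rng G (gmult G a b) = rng G a"
    and assoc: "(a, b) \<in> composable G \<Longrightarrow> (b, c) \<in> composable G \<Longrightarrow>
      gmult G (gmult G a b) c = gmult G a (gmult G b c)"
    and mult_src: "a \<in> arrows G \<Longrightarrow> gmult G a (src G a) = a"
    and mult_rng: "a \<in> arrows G \<Longrightarrow> gmult G (rng G a) a = a"

locale topological_groupoid = groupoid +
  assumes continuous_mult:
      "continuous_map (subtopology (prod_topology (gtop G) (gtop G)) (composable G)) (gtop G)
         (\<lambda>(a, b). gmult G a b)"
    and continuous_inv: "continuous_map (gtop G) (gtop G) (ginv G)"

definition local_homeomorphism :: "'a topology \<Rightarrow> 'b topology \<Rightarrow> ('a \<Rightarrow> 'b) \<Rightarrow> bool" where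
  "local_homeomorphism X Y f \<longleftrightarrow>
     f \<in> topspace X \<rightarrow> topspace Y \<and>
     (\<forall>x \<in> topspace X. \<exists>U. openin X U \<and> x \<in> U \<and> openin Y (f ` U) \<and>
        homeomorphic_map (subtopology X U) (subtopology Y (f ` U)) f)"

definition zero_dimensional_space :: "'a topology \<Rightarrow> bool" where
  "zero_dimensional_space X \<longleftrightarrow>
     (\<forall>W x. openin X W \<and> x \<in> W \<longrightarrow> (\<exists>U. openin X U \<and> closedin X U \<and> x \<in> U \<and> U \<subseteq> W))"

locale etale_groupoid = topological_groupoid +
  assumes etale: "local_homeomorphism (gtop G) (subtopology (gtop G) (units G)) (rng G)"

locale ample_groupoid = etale_groupoid +
  assumes locally_compact: "locally_compact_space (gtop G)"
    and zero_dimensional: "zero_dimensional_space (gtop G)"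

locale ample_Hausdorff_groupoid = ample_groupoid +
  assumes Hausdorff: "Hausdorff_space (gtop G)"

definition bisection :: "'a groupoid \<Rightarrow> 'a set \<Rightarrow> bool" where
  "bisection G A \<longleftrightarrow> A \<subseteq> arrows G \<and> inj_on (src G) A \<and> inj_on (rng G) A"

definition topological_groupoid_iso :: "'a groupoid \<Rightarrow> 'b groupoid \<Rightarrow> ('a \<Rightarrow> 'b) \<Rightarrow> bool" where
  "topological_groupoid_iso H G \<phi> \<longleftrightarrow>
     homeomorphic_map (gtop H) (gtop G) \<phi> \<and>
     (\<forall>(a, b) \<in> composable H.
        (\<phi> a, \<phi> b) \<in> composable G \<and> \<phi> (gmult H a b) = gmult G (\<phi> a) (\<phi> b))"

text \<open>Nontriviality is part of the class \<open>comm_ring_1\<close>.\<close>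

definition indecomposable_ring :: "'r::comm_ring_1 itself \<Rightarrow> bool" where
  "indecomposable_ring _ \<longleftrightarrow> (\<forall>e::'r. e * e = e \<longrightarrow> e = 0 \<or> e = 1)"

text \<open>
  Functions on the groupoid are represented by their extensions by zero to the whole type, so
  two elements of the Steinberg algebra are equal as soon as they agree on \<open>arrows G\<close>.
\<close>

definition steinberg_algebra :: "'a groupoid \<Rightarrow> ('a \<Rightarrow> 'r::comm_ring_1) set" where
  "steinberg_algebra G =
     module.span (\<lambda>(r::'r) f x. r * f x)
       {indicator U | U. compactin (gtop G) U \<and> openin (gtop G) U \<and> bisection G U}"

lemma module_fun: "module (\<lambda>(r::'r::comm_ring_1) (f::'a \<Rightarrow> 'r) x. r * f x)"
  by unfold_locales (auto simp: fun_eq_iff algebra_simps)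

text \<open>
  The index set is restricted to nonzero summands because \<open>sum\<close> over an infinite set is \<open>0\<close>;
  for elements of the Steinberg algebra only finitely many summands are nonzero.
\<close>

definition convolution ::
    "'a groupoid \<Rightarrow> ('a \<Rightarrow> 'r::comm_ring_1) \<Rightarrow> ('a \<Rightarrow> 'r) \<Rightarrow> 'a \<Rightarrow> 'r" where
  "convolution G f g a =
     (\<Sum>(c, d) \<in> {(c, d) \<in> composable G. gmult G c d = a \<and> f c * g d \<noteq> 0}. f c * g d)"

definition supp :: "'a groupoid \<Rightarrow> ('a \<Rightarrow> 'r::comm_ring_1) \<Rightarrow> 'a set" where
  "supp G f = gtop G closure_of {a \<in> arrows G. f a \<noteq> 0}"

definition diagonal :: "'a groupoid \<Rightarrow> ('a \<Rightarrow> 'r::comm_ring_1) set" where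
  "diagonal G = {f \<in> steinberg_algebra G. supp G f \<subseteq> units G}"

definition normalizer :: "'a groupoid \<Rightarrow> ('a \<Rightarrow> 'r::comm_ring_1) \<Rightarrow> bool" where
  "normalizer G f \<longleftrightarrow>
     f \<in> steinberg_algebra G \<and>
     (\<exists>g \<in> steinberg_algebra G.
        (\<forall>d \<in> diagonal G. convolution G (convolution G f d) g \<in> diagonal G) \<and>
        (\<forall>d \<in> diagonal G. convolution G (convolution G g d) f \<in> diagonal G) \<and>
        convolution G (convolution G f g) f = f \<and>
        convolution G (convolution G g f) g = g)"

definition local_bisection_hypothesis :: "'a groupoid \<Rightarrow> 'r::comm_ring_1 itself \<Rightarrow> bool" where
  "local_bisection_hypothesis G _ \<longleftrightarrow>
     (\<forall>f::'a \<Rightarrow> 'r. normalizer G f \<longrightarrow> bisection G (supp G f))"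

text \<open>
  Steinberg algebras need not be unital, so a ring isomorphism is an additive and
  multiplicative bijection.
\<close>

definition steinberg_ring_iso ::
    "'a groupoid \<Rightarrow> 'b groupoid \<Rightarrow>
     (('a \<Rightarrow> 'r::comm_ring_1) \<Rightarrow> ('b \<Rightarrow> 's::comm_ring_1)) \<Rightarrow> bool" where
  "steinberg_ring_iso G H T \<longleftrightarrow>
     bij_betw T (steinberg_algebra G) (steinberg_algebra H) \<and>
     (\<forall>f \<in> steinberg_algebra G. \<forall>g \<in> steinberg_algebra G.
        T (f + g) = T f + T g \<and> T (convolution G f g) = convolution H (T f) (T g))"

definition diagonal_preserving ::
    "'a groupoid \<Rightarrow> 'b groupoid \<Rightarrow>
     (('a \<Rightarrow> 'r::comm_ring_1) \<Rightarrow> ('b \<Rightarrow> 's::comm_ring_1)) \<Rightarrow> bool" where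
  "diagonal_preserving G H T \<longleftrightarrow> T ` diagonal G = diagonal H"

definition Iso_plus :: "('r::comm_ring_1 \<Rightarrow> 's::comm_ring_1) set" where
  "Iso_plus = {h. bij h \<and> (\<forall>x y. h (x + y) = h x + h y)}"

definition Iso_plus_topology :: "('r::comm_ring_1 \<Rightarrow> 's::comm_ring_1) topology" where
  "Iso_plus_topology =
     subtopology (product_topology (\<lambda>_. discrete_topology UNIV) UNIV) Iso_plus"

definition continuous_cocycle ::
    "'b groupoid \<Rightarrow> ('b \<Rightarrow> 'r::comm_ring_1 \<Rightarrow> 's::comm_ring_1) \<Rightarrow> bool" where
  "continuous_cocycle H chi \<longleftrightarrow>
     chi \<in> arrows H \<rightarrow> Iso_plus \<and>
     (\<forall>(a, b) \<in> composable H. \<forall>r s. chi (gmult H a b) (r * s) = chi a r * chi b s) \<and>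
     continuous_map (gtop H) Iso_plus_topology chi"

end

theory Submission
  imports Defs
begin

text \<open>
  Write \<open>1\<^bsub>U\<^esub>\<close> for the characteristic function of a compact open bisection \<open>U\<close> of \<open>G\<close>. It is a
  normalizer, so \<open>T 1\<^bsub>U\<^esub>\<close> is supported in a bisection, and its nonzero values are invertible because
  the ring \<open>S\<close> has no nontrivial idempotents. Disjoint \<open>U\<close> and \<open>V\<close> give \<open>T 1\<^bsub>U\<^esub>\<close> and \<open>T 1\<^bsub>V\<^esub>\<close> with disjoint
  supports. For \<open>b\<close> in \<open>G\<close>, compactness provides a common point \<open>a\<close> of the supports of all \<open>T 1\<^bsub>V\<^esub>\<close>
  with \<open>b \<in> V\<close>, and then \<open>f b = 0\<close> implies \<open>T f a = 0\<close>. Combining this with the same statement for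
  the inverse of \<open>T\<close>, every \<open>a\<close> in \<open>H\<close> has exactly one \<open>b\<close> with \<open>T f a = 0 \<longleftrightarrow> f b = 0\<close> for all \<open>f\<close>.
  The isomorphism maps \<open>a\<close> to \<open>b\<close>, and \<open>T f a\<close> is a function of \<open>f b\<close> alone, which is the cocycle.
\<close>

section \<open>Ample groupoids\<close>

context groupoid
begin

lemma src_inv: "a \<in> arrows G \<Longrightarrow> src G (ginv G a) = rng G a"
  by (simp add: src_def rng_def inv_inv)

lemma rng_inv: "a \<in> arrows G \<Longrightarrow> rng G (ginv G a) = src G a"
  by (simp add: src_def rng_def inv_inv)

lemma composable_iff:
  "(a, b) \<in> composable G \<longleftrightarrow> a \<in> arrows G \<and> b \<in> arrows G \<and> src G a = rng G b"
  by (simp add: composable_def)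

lemma src_closed: "a \<in> arrows G \<Longrightarrow> src G a \<in> arrows G"
  using mult_closed[of "ginv G a" a] by (simp add: composable_iff inv_closed src_inv src_def[symmetric])

lemma rng_closed: "a \<in> arrows G \<Longrightarrow> rng G a \<in> arrows G"
  using src_closed[of "ginv G a"] by (simp add: inv_closed src_inv)

lemma src_src: "a \<in> arrows G \<Longrightarrow> src G (src G a) = src G a"
  using src_mult[of "ginv G a" a] by (simp add: composable_iff inv_closed src_inv src_def[symmetric])

lemma rng_src: "a \<in> arrows G \<Longrightarrow> rng G (src G a) = src G a"
  using rng_mult[of "ginv G a" a]
  by (simp add: composable_iff inv_closed src_inv rng_inv src_def[symmetric])

lemma src_rng: "a \<in> arrows G \<Longrightarrow> src G (rng G a) = rng G a"
  using src_src[of "ginv G a"] by (simp add: inv_closed src_inv)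

lemma rng_rng: "a \<in> arrows G \<Longrightarrow> rng G (rng G a) = rng G a"
  using rng_src[of "ginv G a"] by (simp add: inv_closed src_inv)

lemma units_arrows: "u \<in> units G \<Longrightarrow> u \<in> arrows G"
  by (auto simp: units_def src_closed)

lemma src_unit: "u \<in> units G \<Longrightarrow> src G u = u"
  by (auto simp: units_def src_src)

lemma rng_unit: "u \<in> units G \<Longrightarrow> rng G u = u"
  by (auto simp: units_def rng_src)

lemma src_units: "a \<in> arrows G \<Longrightarrow> src G a \<in> units G"
  by (simp add: units_def)

lemma rng_units: "a \<in> arrows G \<Longrightarrow> rng G a \<in> units G"
  using src_units[of "ginv G a"] by (simp add: inv_closed src_inv)

text \<open>The units form the equalizer of \<open>src\<close> and the identity, which makes them
  closed in the Hausdorff case.\<close>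

lemma units_eq: "units G = {a \<in> arrows G. src G a = a}"
  using src_units by (force simp: units_arrows src_unit)

lemma inv_mult_cancel:
  assumes "c \<in> arrows G" "x \<in> arrows G" "rng G c = rng G x"
  shows "gmult G c (gmult G (ginv G c) x) = x"
  using assoc[of c "ginv G c" x] assms
  by (simp add: composable_iff inv_closed src_inv rng_inv mult_rng rng_def[symmetric])

lemma mult_inv_cancel:
  assumes "(c, d) \<in> composable G"
  shows "gmult G (ginv G c) (gmult G c d) = d"
  using assoc[of "ginv G c" c d] assms
  by (simp add: composable_iff inv_closed src_inv src_def[symmetric]) (simp add: mult_rng)

lemma inv_mult_composable:
  assumes "c \<in> arrows G" "x \<in> arrows G" "rng G c = rng G x"
  shows "(ginv G c, x) \<in> composable G" "(c, gmult G (ginv G c) x) \<in> composable G"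
proof -
  show 1: "(ginv G c, x) \<in> composable G"
    using assms by (simp add: composable_iff inv_closed src_inv)
  show "(c, gmult G (ginv G c) x) \<in> composable G"
    using assms mult_closed[OF 1] rng_mult[OF 1] by (simp add: composable_iff rng_inv)
qed

text \<open>A unit equals its own source, so the product is \<open>rng G v\<close>; multiplying by
  \<open>v\<close> on the right gives \<open>u = v\<close>. Consequently the product of
  \<open>U\<close> with the inverse of a bisection disjoint from \<open>U\<close> contains no
  unit.\<close>

lemma mult_eq_unit:
  assumes "(u, ginv G v) \<in> composable G" "v \<in> arrows G" "gmult G u (ginv G v) \<in> units G"
  shows "u = v"
proof -
  have u: "u \<in> arrows G" and s: "src G u = src G v"
    using assms by (auto simp: composable_iff rng_inv)
  have "gmult G u (ginv G v) = rng G v"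
    using src_mult[OF assms(1)] src_unit[OF assms(3)] assms(2) by (simp add: src_inv)
  moreover have "gmult G (gmult G u (ginv G v)) v = gmult G u (src G v)"
    using assoc[OF assms(1), of v] assms(2)
    by (simp add: composable_iff inv_closed src_inv src_def[symmetric])
  ultimately show ?thesis
    using mult_rng[OF assms(2)] mult_src[OF u] s by simp
qed

lemma bisection_inv: "bisection G U \<Longrightarrow> bisection G (ginv G ` U)"
  unfolding bisection_def
  by (auto simp: inj_on_def inv_closed src_inv rng_inv subset_iff)

lemma inv_image_eq_vimage:
  assumes "U \<subseteq> arrows G"
  shows "ginv G ` U = {x \<in> arrows G. ginv G x \<in> U}"
  using assms by (force simp: inv_closed inv_inv image_iff)

lemma bisection_units: "U \<subseteq> units G \<Longrightarrow> bisection G U"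
  unfolding bisection_def inj_on_def
  by (auto simp: subset_iff units_arrows src_unit rng_unit)

lemma bisection_mono: "bisection G U \<Longrightarrow> V \<subseteq> U \<Longrightarrow> bisection G V"
  unfolding bisection_def by (auto intro: inj_on_subset)

end

text \<open>This is the product in the inverse semigroup of bisections.\<close>

definition set_mult :: "'a groupoid \<Rightarrow> 'a set \<Rightarrow> 'a set \<Rightarrow> 'a set" where
  "set_mult G U V = {gmult G u v | u v. u \<in> U \<and> v \<in> V \<and> (u, v) \<in> composable G}"

text \<open>The source of a product is that of its second factor, which is thereby determined in
  \<open>V\<close>; its range is the source of the first factor, which is then determined in
  \<open>U\<close>. Ranges are treated symmetrically.\<close>

lemma (in groupoid) bisection_set_mult:
  assumes "bisection G U" "bisection G V"
  shows "bisection G (set_mult G U V)"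
proof -
  have "u = u' \<and> v = v'"
    if "u \<in> U" "u' \<in> U" "v \<in> V" "v' \<in> V" "(u, v) \<in> composable G" "(u', v') \<in> composable G"
      "src G v = src G v' \<or> rng G u = rng G u'" for u u' v v'
    using that assms unfolding bisection_def inj_on_def composable_iff by metis
  then show ?thesis
    unfolding bisection_def inj_on_def set_mult_def
    by (auto simp: mult_closed src_mult rng_mult) blast+
qed

section \<open>Continuity and openness of the structure maps\<close>

context topological_groupoid
begin

lemma topspace_arrows [simp]: "topspace (gtop G) = arrows G"
  by (simp add: arrows_def)

lemma continuous_map_mult:
  assumes f: "continuous_map X (gtop G) f" and g: "continuous_map X (gtop G) g"
    and fg: "\<And>x. x \<in> topspace X \<Longrightarrow> (f x, g x) \<in> composable G"
  shows "continuous_map X (gtop G) (\<lambda>x. gmult G (f x) (g x))"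
proof -
  have "continuous_map X (subtopology (prod_topology (gtop G) (gtop G)) (composable G))
          (\<lambda>x. (f x, g x))"
    using f g fg by (auto simp: continuous_map_in_subtopology continuous_map_pairedI)
  from continuous_map_compose[OF this continuous_mult] show ?thesis
    by (simp add: o_def)
qed

lemma continuous_rng: "continuous_map (gtop G) (gtop G) (rng G)"
proof -
  have "continuous_map (gtop G) (gtop G) (\<lambda>x. gmult G x (ginv G x))"
    by (rule continuous_map_mult)
      (use continuous_inv in \<open>auto simp: composable_iff inv_closed rng_inv\<close>)
  then show ?thesis by (simp add: rng_def[abs_def])
qed

lemma continuous_src: "continuous_map (gtop G) (gtop G) (src G)"
proof -
  have "continuous_map (gtop G) (gtop G) (\<lambda>x. gmult G (ginv G x) x)"
    by (rule continuous_map_mult)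
      (use continuous_inv in \<open>auto simp: composable_iff inv_closed src_inv\<close>)
  then show ?thesis by (simp add: src_def[abs_def])
qed

lemma openin_arrows: "openin (gtop G) U \<Longrightarrow> U \<subseteq> arrows G"
  using openin_subset by fastforce

lemma openin_inv_image: "openin (gtop G) U \<Longrightarrow> openin (gtop G) (ginv G ` U)"
  using openin_continuous_map_preimage[OF continuous_inv, of U]
  by (simp add: inv_image_eq_vimage openin_arrows)

end

context etale_groupoid
begin

lemma rng_injective_nhd:
  assumes "a \<in> arrows G"
  obtains E where "openin (gtop G) E" "a \<in> E" "inj_on (rng G) E"
    "openin (subtopology (gtop G) (units G)) (rng G ` E)"
    "homeomorphic_map (subtopology (gtop G) E)
       (subtopology (subtopology (gtop G) (units G)) (rng G ` E)) (rng G)"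
proof -
  obtain E where E: "openin (gtop G) E" "a \<in> E"
    "openin (subtopology (gtop G) (units G)) (rng G ` E)"
    and h: "homeomorphic_map (subtopology (gtop G) E)
       (subtopology (subtopology (gtop G) (units G)) (rng G ` E)) (rng G)"
    using etale assms unfolding local_homeomorphism_def by auto
  have "inj_on (rng G) E"
    using homeomorphic_imp_injective_map[OF h] openin_arrows[OF E(1)] by (simp add: Int_absorb1)
  then show thesis using that E h by blast
qed

text \<open>Where \<open>rng\<close> is injective, \<open>a\<close> and \<open>rng a\<close> have the same range, so they coincide.\<close>

lemma openin_units: "openin (gtop G) (units G)"
proof (subst openin_subopen, intro ballI)
  fix u assume u: "u \<in> units G"
  obtain E where E: "openin (gtop G) E" "u \<in> E" "inj_on (rng G) E"
    using rng_injective_nhd[OF units_arrows[OF u]] .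
  define O' where "O' = E \<inter> {x \<in> arrows G. rng G x \<in> E}"
  have "openin (gtop G) O'"
    unfolding O'_def using openin_continuous_map_preimage[OF continuous_rng E(1)] E(1) by auto
  moreover have "u \<in> O'"
    using u E(2) by (simp add: O'_def units_arrows rng_unit)
  moreover have "O' \<subseteq> units G"
  proof
    fix x assume "x \<in> O'"
    then have "x \<in> E" "rng G x \<in> E" "x \<in> arrows G" by (auto simp: O'_def)
    then have "rng G x = x"
      using E(3) rng_rng by (auto simp: inj_on_def)
    then show "x \<in> units G" using rng_units[OF \<open>x \<in> arrows G\<close>] by simp
  qed
  ultimately show "\<exists>O'. openin (gtop G) O' \<and> u \<in> O' \<and> O' \<subseteq> units G" by blast
qed

text \<open>A local homeomorphism is an open map, and sets open in the unit space are open in the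
  groupoid because the units are open.\<close>

lemma openin_rng_image:
  assumes V: "openin (gtop G) V"
  shows "openin (gtop G) (rng G ` V)"
proof (subst openin_subopen, intro ballI)
  fix y assume "y \<in> rng G ` V"
  then obtain x where x: "x \<in> V" "y = rng G x" by blast
  obtain E where E: "openin (gtop G) E" "x \<in> E"
    "openin (subtopology (gtop G) (units G)) (rng G ` E)"
    and h: "homeomorphic_map (subtopology (gtop G) E)
       (subtopology (subtopology (gtop G) (units G)) (rng G ` E)) (rng G)"
    using rng_injective_nhd openin_arrows[OF V] x(1) by (metis subsetD)
  have "openin (subtopology (gtop G) E) (V \<inter> E)"
    using V openin_subtopology by blast
  then have "openin (subtopology (subtopology (gtop G) (units G)) (rng G ` E)) (rng G ` (V \<inter> E))"
    using homeomorphic_imp_open_map[OF h] by (simp add: open_map_def)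
  then have "openin (gtop G) (rng G ` (V \<inter> E))"
    using E(3) openin_units openin_trans_full by metis
  then show "\<exists>W. openin (gtop G) W \<and> y \<in> W \<and> W \<subseteq> rng G ` V"
    using x E(2) by blast
qed

text \<open>The etale condition only speaks of \<open>rng\<close>. Inverting a neighbourhood of
  \<open>ginv G a\<close> on which \<open>rng\<close> is injective gives a neighbourhood of
  \<open>a\<close> on which \<open>src\<close> is injective; the two kinds of neighbourhood are
  intersected.\<close>

lemma open_bisection_nhd:
  assumes a: "a \<in> arrows G"
  obtains E where "openin (gtop G) E" "a \<in> E" "bisection G E"
proof -
  obtain E where E: "openin (gtop G) E" "a \<in> E" "inj_on (rng G) E"
    using rng_injective_nhd[OF a] .
  obtain F where F: "openin (gtop G) F" "ginv G a \<in> F" "inj_on (rng G) F"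
    using rng_injective_nhd[OF inv_closed[OF a]] .
  define O' where "O' = E \<inter> ginv G ` F"
  have 1: "openin (gtop G) O'"
    unfolding O'_def using E(1) openin_inv_image[OF F(1)] by auto
  have 2: "a \<in> O'"
    using E(2) F(2) inv_inv[OF a] by (force simp: O'_def)
  have "inj_on (src G) (ginv G ` F)"
    using F(3) openin_arrows[OF F(1)] by (force simp: inj_on_def src_inv subset_iff)
  then have "bisection G O'"
    using E(3) openin_arrows[OF 1] unfolding bisection_def O'_def by (auto intro: inj_on_subset)
  then show thesis using that 1 2 by blast
qed

text \<open>
  If \<open>u v\<close> is close to \<open>y\<close>, then \<open>x\<^sup>-\<^sup>1 y\<close> is close to \<open>v\<close> for \<open>x\<close> close to \<open>u\<close> with \<open>rng x = rng y\<close>;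
  such an \<open>x\<close> exists because \<open>rng\<close> is open.
\<close>

lemma openin_set_mult:
  assumes U: "openin (gtop G) U" and V: "openin (gtop G) V"
  shows "openin (gtop G) (set_mult G U V)"
proof (subst openin_subopen, intro ballI)
  fix c assume "c \<in> set_mult G U V"
  then obtain u v where uv: "u \<in> U" "v \<in> V" "(u, v) \<in> composable G" "c = gmult G u v"
    by (auto simp: set_mult_def)
  define X where "X = prod_topology (gtop G) (gtop G)"
  define S where "S = {(x, y) \<in> arrows G \<times> arrows G. rng G x = rng G y}"
  have X: "topspace X = arrows G \<times> arrows G" by (simp add: X_def)
  have fst: "continuous_map (subtopology X S) (gtop G) fst"
    and snd: "continuous_map (subtopology X S) (gtop G) snd"
    by (auto simp: X_def continuous_map_fst continuous_map_snd continuous_map_from_subtopology)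
  have "continuous_map (subtopology X S) (gtop G) (\<lambda>p. gmult G (ginv G (fst p)) (snd p))"
  proof (rule continuous_map_mult[OF _ snd])
    show "continuous_map (subtopology X S) (gtop G) (\<lambda>p. ginv G (fst p))"
      using continuous_map_compose[OF fst continuous_inv] by (simp add: o_def)
  qed (auto simp: S_def X intro: inv_mult_composable)
  from openin_continuous_map_preimage[OF this V]
  obtain O' where O': "openin X O'"
    and eq: "{p \<in> topspace (subtopology X S). gmult G (ginv G (fst p)) (snd p) \<in> V} = O' \<inter> S"
    by (auto simp: openin_subtopology)
  have c: "c \<in> arrows G" "u \<in> arrows G" "rng G u = rng G c"
    using uv mult_closed rng_mult by (auto simp: composable_iff)
  then have "(u, c) \<in> {p \<in> topspace (subtopology X S). gmult G (ginv G (fst p)) (snd p) \<in> V}"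
    using uv by (simp add: X S_def mult_inv_cancel)
  then have "(u, c) \<in> O'" unfolding eq by simp
  then obtain A B where AB: "openin (gtop G) A" "openin (gtop G) B" "u \<in> A" "c \<in> B" "A \<times> B \<subseteq> O'"
    using O' unfolding X_def openin_prod_topology_alt by metis
  define W where "W = B \<inter> {y \<in> arrows G. rng G y \<in> rng G ` (A \<inter> U)}"
  have "openin (gtop G) (rng G ` (A \<inter> U))" using AB(1) U openin_rng_image by blast
  from openin_continuous_map_preimage[OF continuous_rng this]
  have "openin (gtop G) W" unfolding W_def using AB(2) by auto
  moreover have "c \<in> W" 
    unfolding W_def using c AB uv(1) image_eqI[of "rng G c" "rng G" u "A \<inter> U"] by simp
  moreover have "W \<subseteq> set_mult G U V"
  proof
    fix y assume "y \<in> W"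
    then obtain x where x: "x \<in> A" "x \<in> U" "rng G x = rng G y" and y: "y \<in> B" "y \<in> arrows G"
      by (auto simp: W_def)
    have xa: "x \<in> arrows G" using x openin_arrows[OF U] by auto
    have "(x, y) \<in> O' \<inter> S" using AB(5) x y xa by (auto simp: S_def)
    then have "gmult G (ginv G x) y \<in> V" using eq by force
    then show "y \<in> set_mult G U V"
      unfolding set_mult_def using inv_mult_composable[OF xa y(2) x(3)]
        inv_mult_cancel[OF xa y(2) x(3)] x(2) by force
  qed
  ultimately show "\<exists>W. openin (gtop G) W \<and> c \<in> W \<and> W \<subseteq> set_mult G U V" by blast
qed

end

section \<open>Compact open bisections\<close>

definition compact_open_bisection :: "'a groupoid \<Rightarrow> 'a set \<Rightarrow> bool" where
  "compact_open_bisection G U \<longleftrightarrow> compactin (gtop G) U \<and> openin (gtop G) U \<and> bisection G U"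

context ample_Hausdorff_groupoid
begin

lemma compact_open_closed: "compactin (gtop G) U \<Longrightarrow> closedin (gtop G) U"
  using Hausdorff compactin_imp_closedin by blast

lemma compact_open_bisection_arrows: "compact_open_bisection G U \<Longrightarrow> U \<subseteq> arrows G"
  by (simp add: compact_open_bisection_def openin_arrows)

lemma compact_open_bisection_subset:
  assumes "compact_open_bisection G U" "V \<subseteq> U" "openin (gtop G) V" "closedin (gtop G) V"
  shows "compact_open_bisection G V"
  using assms bisection_mono closed_compactin unfolding compact_open_bisection_def by blast

lemma compact_open_bisection_Int:
  assumes "compact_open_bisection G U" "compact_open_bisection G V"
  shows "compact_open_bisection G (U \<inter> V)"
  using compact_open_bisection_subset[OF assms(1), of "U \<inter> V"] assms compact_open_closed
  unfolding compact_open_bisection_def by auto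

lemma compact_open_bisection_Diff:
  assumes "compact_open_bisection G U" "compact_open_bisection G V"
  shows "compact_open_bisection G (U - V)"
  using compact_open_bisection_subset[OF assms(1), of "U - V"] assms compact_open_closed
  unfolding compact_open_bisection_def by (auto simp: openin_diff closedin_diff)

text \<open>These sets form a basis of the topology: zero-dimensionality yields a clopen set inside
  \<open>W\<close>, an open bisection and a compact neighbourhood at once, and a closed subset of a
  compact set is compact.\<close>

lemma compact_open_bisection_nhd:
  assumes W: "openin (gtop G) W" "a \<in> W"
  obtains U where "compact_open_bisection G U" "a \<in> U" "U \<subseteq> W"
proof -
  have a: "a \<in> arrows G" using W openin_arrows by auto
  obtain E where E: "openin (gtop G) E" "a \<in> E" "bisection G E"
    using open_bisection_nhd[OF a] .
  obtain O' C where C: "openin (gtop G) O'" "compactin (gtop G) C" "a \<in> O'" "O' \<subseteq> C"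
    using locally_compact a unfolding locally_compact_space_def topspace_arrows by metis
  have "openin (gtop G) (W \<inter> E \<inter> O')" "a \<in> W \<inter> E \<inter> O'" using W E C by auto
  then obtain U where U: "openin (gtop G) U" "closedin (gtop G) U" "a \<in> U" "U \<subseteq> W \<inter> E \<inter> O'"
    using zero_dimensional unfolding zero_dimensional_space_def by metis
  have "compactin (gtop G) U"
    using closed_compactin[OF C(2), of U] U C(4) by blast
  then have "compact_open_bisection G U"
    using U bisection_mono[OF E(3)] by (auto simp: compact_open_bisection_def)
  then show thesis using that U by blast
qed

lemma compact_open_bisection_ex:
  assumes "a \<in> arrows G"
  obtains U where "compact_open_bisection G U" "a \<in> U"
  using compact_open_bisection_nhd[of "arrows G" a] assms openin_topspace[of "gtop G"]
  unfolding topspace_arrows by blast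

lemma compact_open_bisection_separate:
  assumes "openin (gtop G) W" "a \<in> W" "b \<noteq> a"
  obtains U where "compact_open_bisection G U" "a \<in> U" "U \<subseteq> W" "b \<notin> U"
proof -
  \<comment> \<open>\<open>b\<close> may lie outside the carrier, where \<open>{b}\<close> is not
    closed; the intersection is then empty.\<close>
  have "closedin (gtop G) ({b} \<inter> arrows G)"
    using closedin_Hausdorff_singleton[OF Hausdorff, of b] by (cases "b \<in> arrows G") auto
  then have "openin (gtop G) (W - ({b} \<inter> arrows G))" using assms(1) by auto
  then obtain U where U: "compact_open_bisection G U" "a \<in> U" "U \<subseteq> W - ({b} \<inter> arrows G)"
    using compact_open_bisection_nhd assms by (metis Diff_iff IntD1 singletonD)
  then show thesis using that[of U] compact_open_bisection_arrows by blast
qed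

lemma compact_open_bisection_inv:
  assumes "compact_open_bisection G U"
  shows "compact_open_bisection G (ginv G ` U)"
  using assms image_compactin[OF _ continuous_inv] openin_inv_image bisection_inv
  unfolding compact_open_bisection_def by blast

lemma compact_open_bisection_rng:
  assumes "compact_open_bisection G U"
  shows "compact_open_bisection G (rng G ` U)"
  using assms image_compactin[OF _ continuous_rng] openin_rng_image
    bisection_units[of "rng G ` U"] rng_units compact_open_bisection_arrows[OF assms]
  unfolding compact_open_bisection_def by blast

text \<open>The composable pairs are the equalizer of two continuous maps into a Hausdorff space.
  Hence those taken from two compact sets form a compact set, and so do their products.\<close>

lemma closedin_composable: "closedin (prod_topology (gtop G) (gtop G)) (composable G)"
proof -
  have "closedin (prod_topology (gtop G) (gtop G))
     {p \<in> topspace (prod_topology (gtop G) (gtop G)). (src G \<circ> fst) p = (rng G \<circ> snd) p}"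
    by (intro closedin_continuous_maps_eq[OF Hausdorff]
        continuous_map_compose[OF continuous_map_fst continuous_src]
        continuous_map_compose[OF continuous_map_snd continuous_rng])
  moreover have "{p \<in> topspace (prod_topology (gtop G) (gtop G)).
      (src G \<circ> fst) p = (rng G \<circ> snd) p} = composable G"
    by (auto simp: composable_def)
  ultimately show ?thesis by simp
qed

lemma compact_open_bisection_mult:
  assumes U: "compact_open_bisection G U" and V: "compact_open_bisection G V"
  shows "compact_open_bisection G (set_mult G U V)"
proof -
  have "compactin (prod_topology (gtop G) (gtop G)) ((U \<times> V) \<inter> composable G)"
    using compact_Int_closedin[OF _ closedin_composable, of "U \<times> V"] U V
    by (simp add: compactin_Times compact_open_bisection_def)
  then have "compactin (gtop G) ((\<lambda>(a, b). gmult G a b) ` ((U \<times> V) \<inter> composable G))"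
    using image_compactin[OF _ continuous_mult] by (simp add: compactin_subtopology)
  moreover have "(\<lambda>(a, b). gmult G a b) ` ((U \<times> V) \<inter> composable G) = set_mult G U V"
    by (force simp: set_mult_def)
  ultimately show ?thesis
    using openin_set_mult bisection_set_mult U V by (simp add: compact_open_bisection_def)
qed

lemma closedin_units: "closedin (gtop G) (units G)"
  using closedin_continuous_maps_eq[OF Hausdorff continuous_src continuous_map_id]
  by (simp add: units_eq)

end

section \<open>Steinberg algebras\<close>

text \<open>The coefficient is built into the generator because a ring isomorphism of Steinberg
  algebras is additive but need not be linear over the coefficients.\<close>

definition const_on :: "'a set \<Rightarrow> 'r::comm_ring_1 \<Rightarrow> 'a \<Rightarrow> 'r" where
  "const_on U r x = (if x \<in> U then r else 0)"

lemma const_on_eq_indicator: "const_on U r = (\<lambda>x. r * indicator U x)"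
  by (auto simp: const_on_def fun_eq_iff)

lemma const_on_add: "const_on U (r + s) = const_on U r + const_on U s"
  by (auto simp: const_on_def fun_eq_iff)

lemma const_on_diff: "V \<subseteq> U \<Longrightarrow> const_on U r = const_on V r + const_on (U - V) r"
  by (auto simp: const_on_def fun_eq_iff)

lemma const_on_zero: "const_on U 0 = 0"
  by (auto simp: const_on_def fun_eq_iff)

lemma zero_steinberg: "0 \<in> steinberg_algebra G"
  unfolding steinberg_algebra_def by (rule module.span_zero[OF module_fun])

lemma add_steinberg:
  "f \<in> steinberg_algebra G \<Longrightarrow> g \<in> steinberg_algebra G \<Longrightarrow> f + g \<in> steinberg_algebra G"
  unfolding steinberg_algebra_def by (rule module.span_add[OF module_fun])

lemma diff_steinberg:
  "f \<in> steinberg_algebra G \<Longrightarrow> g \<in> steinberg_algebra G \<Longrightarrow> f - g \<in> steinberg_algebra G"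
  unfolding steinberg_algebra_def by (rule module.span_diff[OF module_fun])

lemma const_on_steinberg:
  "compact_open_bisection G U \<Longrightarrow> const_on U r \<in> steinberg_algebra G"
  unfolding steinberg_algebra_def const_on_eq_indicator
  by (rule module.span_scale[OF module_fun], rule module.span_base[OF module_fun])
    (auto simp: compact_open_bisection_def)

lemma steinberg_induct [consumes 1, case_names zero add]:
  fixes f :: "'a \<Rightarrow> 'r::comm_ring_1"
  assumes f: "f \<in> steinberg_algebra G"
    and zero: "P 0"
    and add: "\<And>r U g. compact_open_bisection G U \<Longrightarrow> g \<in> steinberg_algebra G \<Longrightarrow> P g \<Longrightarrow>
      P (const_on U r + g)"
  shows "P f"
proof -
  have "P f \<and> f \<in> steinberg_algebra G"
    using f[unfolded steinberg_algebra_def]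
  proof (rule module.span_induct_alt[OF module_fun])
    show "P 0 \<and> 0 \<in> steinberg_algebra G" using zero zero_steinberg by auto
    fix c :: 'r and x y :: "'a \<Rightarrow> 'r"
    assume x: "x \<in> {indicator U | U. compactin (gtop G) U \<and> openin (gtop G) U \<and> bisection G U}"
      and y: "P y \<and> y \<in> steinberg_algebra G"
    then obtain U where U: "compact_open_bisection G U" "x = indicator U"
      by (auto simp: compact_open_bisection_def)
    have "(\<lambda>z. c * x z) = const_on U c" by (simp add: U const_on_eq_indicator)
    then show "P ((\<lambda>z. c * x z) + y) \<and> (\<lambda>z. c * x z) + y \<in> steinberg_algebra G"
      using y add[OF U(1)] add_steinberg[OF const_on_steinberg[OF U(1)]] by auto
  qed
  then show ?thesis by simp
qed

section \<open>Convolution\<close>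

lemma convolution_nonzeroE:
  assumes "convolution G f g x \<noteq> 0"
  obtains c d where "(c, d) \<in> composable G" "gmult G c d = x" "f c \<noteq> 0" "g d \<noteq> 0"
proof -
  from sum.not_neutral_contains_not_neutral[OF assms[unfolded convolution_def]]
  obtain p where "p \<in> {(c, d) \<in> composable G. gmult G c d = x \<and> f c * g d \<noteq> 0}" by blast
  then show thesis using that by (force split: prod.splits)
qed

context groupoid
begin

text \<open>A factorization of \<open>a\<close> is determined by its first factor \<open>c\<close>,
  any arrow with the range of \<open>a\<close>. The set \<open>F\<close> may exceed the support of
  \<open>f\<close>, so that sums for several functions can be taken over the same set.\<close>

lemma convolution_eq_sum:
  assumes a: "a \<in> arrows G" and F: "finite F"
    and FD: "\<And>c. c \<in> F \<Longrightarrow> c \<in> arrows G \<and> rng G c = rng G a"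
    and f: "\<And>c. c \<in> arrows G \<Longrightarrow> rng G c = rng G a \<Longrightarrow> c \<notin> F \<Longrightarrow> f c = 0"
  shows "convolution G f g a = (\<Sum>c\<in>F. f c * g (gmult G (ginv G c) a))"
proof -
  define F' where "F' = {c \<in> F. f c * g (gmult G (ginv G c) a) \<noteq> 0}"
  have eq: "{(c, d) \<in> composable G. gmult G c d = a \<and> f c * g d \<noteq> 0}
      = (\<lambda>c. (c, gmult G (ginv G c) a)) ` F'" (is "?I = ?J")
  proof
    show "?J \<subseteq> ?I"
      using FD a by (auto simp: F'_def inv_mult_composable inv_mult_cancel)
    show "?I \<subseteq> ?J"
    proof
      fix p assume "p \<in> ?I"
      then obtain c d where cd: "(c, d) \<in> composable G" "f c * g d \<noteq> 0" "a = gmult G c d"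
        and p: "p = (c, d)" by blast
      have c: "c \<in> arrows G" "rng G c = rng G a"
        using cd rng_mult[OF cd(1)] by (auto simp: composable_iff)
      have d: "d = gmult G (ginv G c) a" using mult_inv_cancel[OF cd(1)] cd(3) by simp
      have "f c \<noteq> 0" using cd(2) by auto
      then have "c \<in> F" using f[OF c] by blast
      then have "c \<in> F'" using cd(2) d unfolding F'_def by (metis (mono_tags, lifting) mem_Collect_eq)
      then show "p \<in> ?J" unfolding p by (rule image_eqI[rotated]) (use d in simp)
    qed
  qed
  have "convolution G f g a = (\<Sum>c\<in>F'. f c * g (gmult G (ginv G c) a))"
    unfolding convolution_def eq by (subst sum.reindex) (auto simp: inj_on_def)
  also have "\<dots> = (\<Sum>c\<in>F. f c * g (gmult G (ginv G c) a))"
    by (rule sum.mono_neutral_left) (use F in \<open>auto simp: F'_def\<close>)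
  finally show ?thesis .
qed

lemma convolution_single:
  assumes "a \<in> arrows G" "c \<in> arrows G" "rng G c = rng G a"
    and "\<And>c'. c' \<in> arrows G \<Longrightarrow> rng G c' = rng G a \<Longrightarrow> f c' \<noteq> 0 \<Longrightarrow> c' = c"
  shows "convolution G f g a = f c * g (gmult G (ginv G c) a)"
proof -
  have "convolution G f g a = (\<Sum>c\<in>{c}. f c * g (gmult G (ginv G c) a))"
  proof (rule convolution_eq_sum[OF assms(1)])
    show "f c' = 0" if "c' \<in> arrows G" "rng G c' = rng G a" "c' \<notin> {c}" for c'
      using assms(4)[OF that(1,2)] that(3) by blast
  qed (use assms(2,3) in auto)
  then show ?thesis by simp
qed

text \<open>The sum has a single term. The second premise holds whenever \<open>f\<close> is
  supported in a bisection and \<open>f a\<close> is nonzero.\<close>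

lemma convolution_composable:
  assumes ab: "(a, b) \<in> composable G"
    and "\<And>c. c \<in> arrows G \<Longrightarrow> rng G c = rng G a \<Longrightarrow> f c \<noteq> 0 \<Longrightarrow> c = a"
  shows "convolution G f g (gmult G a b) = f a * g b"
proof -
  have "convolution G f g (gmult G a b) = f a * g (gmult G (ginv G a) (gmult G a b))"
  proof (rule convolution_single[OF mult_closed[OF ab]])
    show "a \<in> arrows G" "rng G a = rng G (gmult G a b)"
      using ab rng_mult[OF ab] by (simp_all add: composable_iff)
  qed (use assms(2) rng_mult[OF ab] in metis)
  then show ?thesis by (simp only: mult_inv_cancel[OF ab])
qed

text \<open>The only unit with range \<open>rng G x\<close> is \<open>rng G x\<close> itself, so
  only the factorization of \<open>x\<close> into \<open>rng G x\<close> and \<open>x\<close>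
  contributes. Diagonal elements thus act on the left by pointwise multiplication along
  \<open>rng\<close>.\<close>

lemma convolution_unit_support:
  assumes "\<And>c. c \<in> arrows G \<Longrightarrow> d c \<noteq> 0 \<Longrightarrow> c \<in> units G" "x \<in> arrows G"
  shows "convolution G d f x = d (rng G x) * f x"
proof -
  have "c = rng G x" if "c \<in> arrows G" "rng G c = rng G (rng G x)" "d c \<noteq> 0" for c
    using rng_unit[OF assms(1)] that assms(2) by (simp add: rng_rng)
  then have "convolution G d f (gmult G (rng G x) x) = d (rng G x) * f x"
    using assms(2) by (intro convolution_composable) (auto simp: composable_iff rng_closed src_rng)
  then show ?thesis using assms by (simp add: mult_rng)
qed

lemma convolution_outside: "x \<notin> arrows G \<Longrightarrow> convolution G f g x = 0"
  by (metis convolution_nonzeroE mult_closed)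

lemma convolution_const_on:
  assumes U: "bisection G U" and V: "V \<subseteq> arrows G"
  shows "convolution G (const_on U r) (const_on V s) = const_on (set_mult G U V) (r * s)"
proof
  fix x
  show "convolution G (const_on U r) (const_on V s) x = const_on (set_mult G U V) (r * s) x"
  proof (cases "x \<in> set_mult G U V")
    case True
    then obtain u v where uv: "u \<in> U" "v \<in> V" "(u, v) \<in> composable G" "x = gmult G u v"
      by (auto simp: set_mult_def)
    have "convolution G (const_on U r) (const_on V s) x = const_on U r u * const_on V s v"
      unfolding uv(4) using uv(1) U
      by (intro convolution_composable[OF uv(3)])
        (auto simp: const_on_def bisection_def inj_on_def split: if_splits)
    then show ?thesis using True uv by (simp add: const_on_def)
  next
    case False
    have "convolution G (const_on U r) (const_on V s) x = 0"
    proof (rule ccontr)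
      assume "convolution G (const_on U r) (const_on V s) x \<noteq> 0"
      then show False
        by (rule convolution_nonzeroE)
          (use False in \<open>auto simp: const_on_def set_mult_def split: if_splits\<close>)
    qed
    then show ?thesis using False by (simp add: const_on_def)
  qed
qed

lemma set_mult_inv:
  assumes "bisection G U"
  shows "set_mult G U (ginv G ` U) = rng G ` U"
proof -
  have "x \<in> rng G ` U" if x: "x \<in> set_mult G U (ginv G ` U)" for x
  proof -
    obtain u v where uv: "u \<in> U" "v \<in> U" "(u, ginv G v) \<in> composable G" "x = gmult G u (ginv G v)"
      using x unfolding set_mult_def by blast
    have "u = v"
      using uv assms by (auto simp: bisection_def composable_iff inj_on_def rng_inv subset_iff)
    then show ?thesis using uv by (simp add: rng_def)
  qed
  moreover have "rng G u \<in> set_mult G U (ginv G ` U)" if "u \<in> U" for u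
  proof -
    have "(u, ginv G u) \<in> composable G"
      using that assms by (auto simp: bisection_def composable_iff rng_inv inv_closed)
    then show ?thesis using that unfolding set_mult_def rng_def by blast
  qed
  ultimately show ?thesis by blast
qed

lemma set_mult_rng:
  assumes "bisection G U" "V \<subseteq> U"
  shows "set_mult G (rng G ` V) U = V"
proof -
  have "x \<in> set_mult G (rng G ` V) U" if "x \<in> V" for x
  proof -
    have "x \<in> arrows G" "x \<in> U" using that assms by (auto simp: bisection_def)
    then have "x = gmult G (rng G x) x \<and> rng G x \<in> rng G ` V \<and> x \<in> U \<and>
        (rng G x, x) \<in> composable G"
      using that by (simp add: composable_iff rng_closed src_rng mult_rng)
    then show ?thesis unfolding set_mult_def by blast
  qed
  moreover have "set_mult G (rng G ` V) U \<subseteq> V"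
  proof
    fix y assume "y \<in> set_mult G (rng G ` V) U"
    then obtain v u where vu: "v \<in> V" "u \<in> U" "src G (rng G v) = rng G u" "y = gmult G (rng G v) u"
      by (auto simp: set_mult_def composable_iff)
    then have "v = u" using assms by (auto simp: bisection_def inj_on_def src_rng subset_iff)
    then show "y \<in> V" using vu assms by (auto simp: bisection_def mult_rng subset_iff)
  qed
  ultimately show ?thesis by blast
qed

end

section \<open>Steinberg algebra elements as locally constant functions with compact support\<close>

context ample_Hausdorff_groupoid
begin

lemma steinberg_outside:
  assumes "f \<in> steinberg_algebra G" "x \<notin> arrows G"
  shows "f x = 0"
  using assms by (induction rule: steinberg_induct)
    (auto simp: const_on_def dest: compact_open_bisection_arrows)

lemma steinberg_locally_constant:
  assumes "f \<in> steinberg_algebra G" "a \<in> arrows G"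
  shows "\<exists>W. openin (gtop G) W \<and> a \<in> W \<and> (\<forall>x\<in>W. f x = f a)"
  using assms
proof (induction rule: steinberg_induct)
  case zero
  then show ?case using openin_topspace[of "gtop G"] by auto
next
  case (add r U g)
  then obtain W where W: "openin (gtop G) W" "a \<in> W" "\<forall>x\<in>W. g x = g a" by blast
  \<comment> \<open>A compact open set in a Hausdorff space is clopen, so either \<open>U\<close> or
    its complement is a neighbourhood of \<open>a\<close> on which \<open>const_on U r\<close> is
    constant.\<close>
  have "openin (gtop G) (arrows G - U)"
    using add(1) openin_diff[of "gtop G" "arrows G" U] openin_topspace[of "gtop G"]
      compact_open_closed by (simp add: compact_open_bisection_def)
  moreover have "openin (gtop G) U" using add(1) by (simp add: compact_open_bisection_def)
  ultimately have "\<exists>O'. openin (gtop G) O' \<and> a \<in> O' \<and> (\<forall>x\<in>O'. const_on U r x = const_on U r a)"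
    using add.prems by (cases "a \<in> U") (auto simp: const_on_def intro: exI[of _ U] exI[of _ "arrows G - U"])
  then obtain O' where "openin (gtop G) O'" "a \<in> O'" "\<forall>x\<in>O'. const_on U r x = const_on U r a"
    by blast
  moreover from this W have "(const_on U r + g) x = (const_on U r + g) a" if "x \<in> O' \<inter> W" for x
    using that by (metis IntE plus_fun_apply)
  ultimately show ?case using W by (meson IntI openin_Int)
qed

lemma openin_steinberg_vimage:
  assumes "f \<in> steinberg_algebra G"
  shows "openin (gtop G) {x \<in> arrows G. P (f x)}"
proof (subst openin_subopen, intro ballI)
  fix a assume a: "a \<in> {x \<in> arrows G. P (f x)}"
  then obtain W where W: "openin (gtop G) W" "a \<in> W" and eq: "\<forall>x\<in>W. f x = f a"
    using steinberg_locally_constant[OF assms] by blast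
  have "W \<subseteq> {x \<in> arrows G. P (f x)}"
  proof
    fix x assume "x \<in> W"
    then show "x \<in> {x \<in> arrows G. P (f x)}"
      using a bspec[OF eq \<open>x \<in> W\<close>] openin_arrows[OF W(1)] by auto
  qed
  then show "\<exists>W. openin (gtop G) W \<and> a \<in> W \<and> W \<subseteq> {x \<in> arrows G. P (f x)}"
    using W by blast
qed

lemma closedin_steinberg_support:
  assumes "f \<in> steinberg_algebra G"
  shows "closedin (gtop G) {x \<in> arrows G. f x \<noteq> 0}"
proof -
  have "arrows G - {x \<in> arrows G. f x \<noteq> 0} = {x \<in> arrows G. f x = 0}" by auto
  then show ?thesis
    using openin_steinberg_vimage[OF assms, of "\<lambda>y. y = 0"] by (simp add: closedin_def)
qed

lemma compactin_steinberg_support: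
  assumes "f \<in> steinberg_algebra G"
  shows "compactin (gtop G) {x \<in> arrows G. f x \<noteq> 0}"
proof -
  have "\<exists>K. compactin (gtop G) K \<and> {x \<in> arrows G. f x \<noteq> 0} \<subseteq> K"
    using assms
  proof (induction rule: steinberg_induct)
    case zero
    then show ?case by (intro exI[of _ "{}"]) auto
  next
    case (add r U g)
    then obtain K where "compactin (gtop G) K" "{x \<in> arrows G. g x \<noteq> 0} \<subseteq> K" by blast
    with add(1) show ?case
      by (intro exI[of _ "U \<union> K"])
        (auto simp: const_on_def compact_open_bisection_def compactin_Un)
  qed
  then show ?thesis
    using closed_compactin closedin_steinberg_support[OF assms] by blast
qed

text \<open>Local constancy makes the nonvanishing set closed already, so the closure adds
  nothing.\<close>

lemma supp_steinberg: "f \<in> steinberg_algebra G \<Longrightarrow> supp G f = {x \<in> arrows G. f x \<noteq> 0}"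
  unfolding supp_def by (simp add: closedin_steinberg_support closure_of_closedin)

text \<open>A bisection meets each fibre of \<open>rng\<close> in at most one arrow, so each
  generator adds at most one point. This makes the convolution sums finite.\<close>

lemma finite_steinberg_fibre:
  assumes "f \<in> steinberg_algebra G"
  shows "finite {c \<in> arrows G. rng G c = x \<and> f c \<noteq> 0}"
  using assms
proof (induction rule: steinberg_induct)
  case zero
  then show ?case by simp
next
  case (add r U g)
  have "finite {c \<in> U. rng G c = x}"
  proof (cases "\<exists>u\<in>U. rng G u = x")
    case True
    then obtain u where "u \<in> U" "rng G u = x" by blast
    then have "{c \<in> U. rng G c = x} \<subseteq> {u}"
      using add(1) by (auto simp: compact_open_bisection_def bisection_def inj_on_def)
    then show ?thesis by (rule finite_subset) simp
  next
    case False
    then have "{c \<in> U. rng G c = x} = {}" by blast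
    then show ?thesis by (metis finite.emptyI)
  qed
  then have "finite ({c \<in> U. rng G c = x} \<union> {c \<in> arrows G. rng G c = x \<and> g c \<noteq> 0})"
    using add.IH by simp
  then show ?case by (rule rev_finite_subset) (auto simp: const_on_def)
qed

lemma convolution_add_left:
  assumes f: "f \<in> steinberg_algebra G" and f': "f' \<in> steinberg_algebra G"
  shows "convolution G (f + f') g = convolution G f g + convolution G f' g"
proof
  fix a
  show "convolution G (f + f') g a = (convolution G f g + convolution G f' g) a"
  proof (cases "a \<in> arrows G")
    case True
    \<comment> \<open>The index set in \<open>convolution\<close> depends on the functions; a common
      finite set is needed before the sums can be added.\<close>
    define F where "F = {c \<in> arrows G. rng G c = rng G a \<and> f c \<noteq> 0}
      \<union> {c \<in> arrows G. rng G c = rng G a \<and> f' c \<noteq> 0}"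
    have "finite F" unfolding F_def using finite_steinberg_fibre f f' by blast
    then have "convolution G h g a = (\<Sum>c\<in>F. h c * g (gmult G (ginv G c) a))"
      if "h \<in> {f, f', f + f'}" for h
      using that by (intro convolution_eq_sum[OF True]) (auto simp: F_def)
    then show ?thesis by (simp add: distrib_right sum.distrib)
  qed (simp add: convolution_outside)
qed

lemma convolution_add_right:
  assumes f: "f \<in> steinberg_algebra G"
  shows "convolution G f (g + g') = convolution G f g + convolution G f g'"
proof
  fix a
  show "convolution G f (g + g') a = (convolution G f g + convolution G f g') a"
  proof (cases "a \<in> arrows G")
    case True
    have "convolution G f h a = (\<Sum>c \<in> {c \<in> arrows G. rng G c = rng G a \<and> f c \<noteq> 0}.
        f c * h (gmult G (ginv G c) a))" for h
      using finite_steinberg_fibre[OF f] by (intro convolution_eq_sum[OF True]) auto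
    then show ?thesis by (simp add: distrib_left sum.distrib)
  qed (simp add: convolution_outside)
qed

lemma convolution_zero_left: "convolution G 0 f = 0"
  by (rule ext, rule ccontr) (auto elim: convolution_nonzeroE)

lemma convolution_zero_right: "convolution G f 0 = 0"
  by (rule ext, rule ccontr) (auto elim: convolution_nonzeroE)

lemma convolution_steinberg:
  assumes f: "f \<in> steinberg_algebra G" and g: "g \<in> steinberg_algebra G"
  shows "convolution G f g \<in> steinberg_algebra G"
  using f
proof (induction rule: steinberg_induct)
  case zero
  then show ?case using zero_steinberg by (metis convolution_zero_left)
next
  case (add r U f)
  have "convolution G (const_on U r) g \<in> steinberg_algebra G"
    using g
  proof (induction rule: steinberg_induct)
    case zero
    then show ?case using zero_steinberg by (metis convolution_zero_right)
  next
    case (add s V g)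
    have "convolution G (const_on U r) (const_on V s) = const_on (set_mult G U V) (r * s)"
      using \<open>compact_open_bisection G U\<close> add(1)
      by (intro convolution_const_on) (auto simp: compact_open_bisection_def bisection_def)
    then show ?case
      using \<open>compact_open_bisection G U\<close> add
      by (metis convolution_add_right const_on_steinberg add_steinberg compact_open_bisection_mult)
  qed
  then show ?case using add by (metis convolution_add_left const_on_steinberg add_steinberg)
qed

lemma diagonal_iff:
  "f \<in> diagonal G \<longleftrightarrow> f \<in> steinberg_algebra G \<and> (\<forall>x\<in>arrows G. f x \<noteq> 0 \<longrightarrow> x \<in> units G)"
  unfolding diagonal_def mem_Collect_eq
  by (rule conj_cong[OF refl]) (use supp_steinberg in blast)

lemma const_on_diagonal:
  "compact_open_bisection G U \<Longrightarrow> U \<subseteq> units G \<Longrightarrow> const_on U r \<in> diagonal G"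
  unfolding diagonal_iff by (auto simp: const_on_steinberg) (auto simp: const_on_def split: if_splits)

lemma diagonal_convolution:
  "d \<in> diagonal G \<Longrightarrow> x \<in> arrows G \<Longrightarrow> convolution G d f x = d (rng G x) * f x"
  by (rule convolution_unit_support) (simp_all add: diagonal_iff)

section \<open>Characteristic functions as normalizers\<close>

lemma convolution_const_on_inv:
  assumes "compact_open_bisection G U"
  shows "convolution G (const_on U 1) (const_on (ginv G ` U) 1) = const_on (rng G ` U) 1"
proof -
  have U: "bisection G U" using assms by (simp add: compact_open_bisection_def)
  show ?thesis
    using convolution_const_on[OF U
        compact_open_bisection_arrows[OF compact_open_bisection_inv[OF assms]], of 1 1]
    by (simp add: set_mult_inv[OF U])
qed

text \<open>Since \<open>rng\<close> is injective on \<open>U\<close>, restricting ranges to those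
  of \<open>V\<close> cuts \<open>U\<close> down to \<open>V\<close>. Every piece of
  \<open>U\<close>, with any coefficient, is thus reached from \<open>const_on U 1\<close> by a
  diagonal factor.\<close>

lemma convolution_rng_const_on:
  assumes "compact_open_bisection G U" "V \<subseteq> U"
  shows "convolution G (const_on (rng G ` V) r) (const_on U 1) = const_on V r"
proof -
  have V: "rng G ` V \<subseteq> units G" using assms compact_open_bisection_arrows rng_units by blast
  have U: "bisection G U" using assms(1) by (simp add: compact_open_bisection_def)
  show ?thesis
    using convolution_const_on[OF bisection_units[OF V] compact_open_bisection_arrows[OF assms(1)],
        of r 1]
    unfolding set_mult_rng[OF U assms(2)] by simp
qed

text \<open>A nonzero value at \<open>x\<close> requires \<open>x\<close> to be a product of some
  \<open>u\<close> in \<open>U\<close>, a unit, and the inverse of some \<open>w\<close> in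
  \<open>U\<close>. Then \<open>u\<close> and \<open>w\<close> have the same source, so they are
  equal and \<open>x\<close> is \<open>rng G u\<close>.\<close>

lemma normalizer_const_on_aux:
  fixes d :: "'a \<Rightarrow> 'r::comm_ring_1"
  assumes U: "compact_open_bisection G U" and d: "d \<in> diagonal G"
  shows "convolution G (convolution G (const_on U 1) d) (const_on (ginv G ` U) 1) \<in> diagonal G"
proof -
  define h where "h = convolution G (convolution G (const_on U 1) d) (const_on (ginv G ` U) 1)"
  have dA: "d \<in> steinberg_algebra G" and dU: "\<And>x. x \<in> arrows G \<Longrightarrow> d x \<noteq> 0 \<Longrightarrow> x \<in> units G"
    using d unfolding diagonal_iff by blast+
  have "h \<in> steinberg_algebra G"
    unfolding h_def
    by (intro convolution_steinberg const_on_steinberg U dA compact_open_bisection_inv)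
  moreover have "x \<in> units G" if x: "h x \<noteq> 0" for x
  proof -
    obtain c v where cv: "(c, v) \<in> composable G" "gmult G c v = x"
      "convolution G (const_on U 1) d c \<noteq> 0" "const_on (ginv G ` U) (1::'r) v \<noteq> 0"
      using x unfolding h_def by (rule convolution_nonzeroE)
    obtain w where w: "w \<in> U" "v = ginv G w"
      using cv(4) by (auto simp: const_on_def split: if_splits)
    obtain u e where ue: "(u, e) \<in> composable G" "gmult G u e = c"
      "const_on U (1::'r) u \<noteq> 0" "d e \<noteq> 0"
      using cv(3) by (rule convolution_nonzeroE)
    have u: "u \<in> U" using ue(3) by (auto simp: const_on_def split: if_splits)
    have a: "u \<in> arrows G" "e \<in> arrows G" "src G u = rng G e" using ue(1) by (auto simp: composable_iff)
    have "rng G e = e" using rng_unit[OF dU[OF a(2) ue(4)]] .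
    then have c: "c = u" using ue(2) mult_src[OF a(1)] a(3) by simp
    have w': "w \<in> arrows G" using w(1) U compact_open_bisection_arrows by blast
    have "src G u = src G w" using cv(1) c w(2) w' by (simp add: composable_iff rng_inv)
    then have "u = w"
      using U u w(1) unfolding compact_open_bisection_def bisection_def inj_on_def by blast
    then have "x = rng G u" using cv(2) c w(2) by (simp add: rng_def)
    then show ?thesis using rng_units[OF a(1)] by simp
  qed
  ultimately show ?thesis unfolding diagonal_iff h_def by blast
qed

lemma normalizer_const_on:
  assumes U: "compact_open_bisection G U"
  shows "normalizer G (const_on U (1::'r::comm_ring_1))"
proof -
  note U' = compact_open_bisection_inv[OF U]
  have "(\<lambda>x. ginv G (ginv G x)) ` U = (\<lambda>x. x) ` U"
    using compact_open_bisection_arrows[OF U] by (intro image_cong) (auto simp: inv_inv)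
  then have inv: "ginv G ` ginv G ` U = U" by (simp add: image_image)
  let ?f = "const_on U (1::'r)" and ?g = "const_on (ginv G ` U) (1::'r)"
  have "convolution G (convolution G ?f ?g) ?f = ?f" "convolution G (convolution G ?g ?f) ?g = ?g"
    by (simp_all add: convolution_const_on_inv[OF U]
        convolution_const_on_inv[OF U', unfolded inv]
        convolution_rng_const_on[OF U order_refl] convolution_rng_const_on[OF U' order_refl])
  moreover have "\<forall>d\<in>diagonal G. convolution G (convolution G ?f d) ?g \<in> diagonal G"
    "\<forall>d\<in>diagonal G. convolution G (convolution G ?g d) ?f \<in> diagonal G"
    by (blast intro: normalizer_const_on_aux[OF U] normalizer_const_on_aux[OF U', unfolded inv])+
  ultimately show ?thesis
    unfolding normalizer_def using const_on_steinberg[OF U] const_on_steinberg[OF U'] by blast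
qed

end

section \<open>Isomorphisms preserving the diagonal\<close>

text \<open>The assumptions on idempotents and normalizers concern the target of \<open>T\<close>.
  The locale is instantiated a second time for the inverse of \<open>T\<close>, whose target is the
  algebra of \<open>G\<close>.\<close>

locale diagonal_isomorphism =
  G: ample_Hausdorff_groupoid G + H: ample_Hausdorff_groupoid H
  for G :: "'g groupoid" and H :: "'h groupoid" +
  fixes T :: "('g \<Rightarrow> 'r::comm_ring_1) \<Rightarrow> ('h \<Rightarrow> 's::comm_ring_1)"
  assumes indecomposable: "indecomposable_ring TYPE('s)"
    and local_bisection: "local_bisection_hypothesis H TYPE('s)"
    and iso: "steinberg_ring_iso G H T"
    and diag: "diagonal_preserving G H T"
begin

section \<open>Transfer of the algebraic structure along \<open>T\<close>\<close>

lemma T_bij: "bij_betw T (steinberg_algebra G) (steinberg_algebra H)"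
  using iso[unfolded steinberg_ring_iso_def] by (rule conjunct1)

lemmas T_image = bij_betw_imp_surj_on[OF T_bij]
lemmas T_inj_on = bij_betw_imp_inj_on[OF T_bij]

lemma T_closed: "f \<in> steinberg_algebra G \<Longrightarrow> T f \<in> steinberg_algebra H"
  using bij_betw_apply[OF T_bij] .

lemma T_inj: "f \<in> steinberg_algebra G \<Longrightarrow> g \<in> steinberg_algebra G \<Longrightarrow> T f = T g \<Longrightarrow> f = g"
  by (rule inj_onD[OF T_inj_on])

lemma T_add: "f \<in> steinberg_algebra G \<Longrightarrow> g \<in> steinberg_algebra G \<Longrightarrow> T (f + g) = T f + T g"
  by (rule iso[unfolded steinberg_ring_iso_def, THEN conjunct2, rule_format, THEN conjunct1])

lemma T_convolution:
  "f \<in> steinberg_algebra G \<Longrightarrow> g \<in> steinberg_algebra G \<Longrightarrow>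
    T (convolution G f g) = convolution H (T f) (T g)"
  by (rule iso[unfolded steinberg_ring_iso_def, THEN conjunct2, rule_format, THEN conjunct2])

lemma T_zero: "T 0 = 0"
  by (rule add_cancel_right_right[THEN iffD1])
    (rule T_add[OF zero_steinberg zero_steinberg, unfolded add_0_left])

lemma T_surj:
  assumes "h \<in> steinberg_algebra H"
  obtains f where "f \<in> steinberg_algebra G" "T f = h"
  using assms that unfolding T_image[symmetric] by (elim imageE) simp

lemma T_diagonal_image: "T ` diagonal G = diagonal H"
  using diag unfolding diagonal_preserving_def .

lemma T_diagonal: "d \<in> diagonal G \<Longrightarrow> T d \<in> diagonal H"
  unfolding T_diagonal_image[symmetric] by (rule imageI)

lemma T_diagonal_surj:
  assumes "e \<in> diagonal H"
  obtains d where "d \<in> diagonal G" "T d = e"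
  using assms that unfolding T_diagonal_image[symmetric] by (elim imageE) simp

lemma T_diagonal_iff:
  assumes "f \<in> steinberg_algebra G"
  shows "T f \<in> diagonal H \<longleftrightarrow> f \<in> diagonal G"
proof
  assume "T f \<in> diagonal H"
  then obtain d where d: "d \<in> diagonal G" "T d = T f" by (rule T_diagonal_surj)
  then have "d \<in> steinberg_algebra G" by (simp add: G.diagonal_iff)
  then have "d = f" by (rule T_inj[OF _ assms d(2)])
  then show "f \<in> diagonal G" using d(1) by simp
qed (rule T_diagonal)

text \<open>Normalizers are described by products and the diagonal alone, so \<open>T g\<close>
  serves as partner of \<open>T f\<close>. Each diagonal element of the target has a diagonal
  preimage, which handles the quantifiers.\<close>

lemma T_normalizer:
  assumes "normalizer G f"
  shows "normalizer H (T f)"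
proof -
  obtain g where f: "f \<in> steinberg_algebra G" and g: "g \<in> steinberg_algebra G"
    and D: "\<forall>d\<in>diagonal G. convolution G (convolution G f d) g \<in> diagonal G"
      "\<forall>d\<in>diagonal G. convolution G (convolution G g d) f \<in> diagonal G"
    and fgf: "convolution G (convolution G f g) f = f" "convolution G (convolution G g f) g = g"
    using assms unfolding normalizer_def by blast
  have T3: "convolution H (convolution H (T h) (T k)) (T l) = T (convolution G (convolution G h k) l)"
    if "h \<in> steinberg_algebra G" "k \<in> steinberg_algebra G" "l \<in> steinberg_algebra G" for h k l
    using that by (simp only: T_convolution G.convolution_steinberg)
  have *: "convolution H (convolution H (T h) e) (T k) \<in> diagonal H"
    if h: "h \<in> steinberg_algebra G" and k: "k \<in> steinberg_algebra G" and e: "e \<in> diagonal H"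
      and D: "\<forall>d\<in>diagonal G. convolution G (convolution G h d) k \<in> diagonal G" for h k e
  proof -
    obtain d where d: "d \<in> diagonal G" "T d = e" using e by (rule T_diagonal_surj)
    then have "d \<in> steinberg_algebra G" by (simp add: G.diagonal_iff)
    with d h k D show ?thesis using T3[of h d k] T_diagonal by metis
  qed
  show ?thesis
    unfolding normalizer_def
  proof (intro conjI bexI[of _ "T g"] ballI)
    show "convolution H (convolution H (T f) (T g)) (T f) = T f"
      by (simp only: T3[OF f g f] fgf)
    show "convolution H (convolution H (T g) (T f)) (T g) = T g"
      by (simp only: T3[OF g f g] fgf)
    show "convolution H (convolution H (T f) e) (T g) \<in> diagonal H" if "e \<in> diagonal H" for e
      by (rule *[OF f g that D(1)])
    show "convolution H (convolution H (T g) e) (T f) \<in> diagonal H" if "e \<in> diagonal H" for e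
      by (rule *[OF g f that D(2)])
  qed (rule T_closed[OF f] T_closed[OF g])+
qed

section \<open>Supports of images of characteristic functions\<close>

lemma bisection_T_support:
  assumes "compact_open_bisection G U"
  shows "bisection H {x \<in> arrows H. T (const_on U 1) x \<noteq> 0}"
proof -
  have "bisection H (supp H (T (const_on U 1)))"
    using local_bisection T_normalizer[OF G.normalizer_const_on[OF assms]]
    unfolding local_bisection_hypothesis_def by blast
  then show ?thesis
    by (simp only: H.supp_steinberg[OF T_closed[OF const_on_steinberg[OF assms]]])
qed

lemma T_const_on_rng_cong:
  assumes U: "compact_open_bisection G U" and "T (const_on U 1) a \<noteq> 0" "T (const_on U 1) c \<noteq> 0"
    and "a \<in> arrows H" "c \<in> arrows H" "rng H c = rng H a"
  shows "c = a"
  using bisection_T_support[OF U] assms(2-) unfolding bisection_def inj_on_def by blast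

text \<open>
  By indecomposability, the diagonal idempotent \<open>T (1\<^bsub>U\<^esub> * 1\<^bsub>V\<^esub>)\<close>, \<open>V = U\<^sup>-\<^sup>1\<close>, has no values
  other than 0 and 1.
\<close>

lemma T_const_on_unit:
  assumes U: "compact_open_bisection G U" and a: "a \<in> arrows H" and nz: "T (const_on U 1) a \<noteq> 0"
  shows "T (const_on U 1) a * T (const_on (ginv G ` U) 1) (ginv H a) = 1"
proof -
  define f where "f = T (const_on U 1)"
  define g where "g = T (const_on (ginv G ` U) 1)"
  define h where "h = T (const_on (rng G ` U) 1)"
  note mem = const_on_steinberg[OF U] const_on_steinberg[OF G.compact_open_bisection_inv[OF U]]
    const_on_steinberg[OF G.compact_open_bisection_rng[OF U]]
  have rU: "rng G ` U \<subseteq> units G" using G.compact_open_bisection_arrows[OF U] G.rng_units by blast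
  note rngU = G.compact_open_bisection_rng[OF U]
  have hD: "h \<in> diagonal H" unfolding h_def by (intro T_diagonal G.const_on_diagonal rngU rU)
  have "rng G ` rng G ` U = (\<lambda>u. u) ` rng G ` U"
    using rU by (intro image_cong) (auto simp: G.rng_unit)
  then have hh: "convolution H h h = h"
    unfolding h_def
    using G.convolution_rng_const_on[OF rngU order_refl, of "1::'r"] T_convolution[OF mem(3)[of 1] mem(3)[of 1]]
    by (simp only: image_ident)
  have hf: "convolution H h f = f"
    unfolding h_def f_def
    using G.convolution_rng_const_on[OF U order_refl, of "1::'r"] T_convolution[OF mem(3)[of 1] mem(1)[of 1]] by simp
  have fg: "convolution H f g = h"
    unfolding h_def f_def g_def
    using T_convolution[OF mem(1)[of 1] mem(2)[of 1]] by (simp add: G.convolution_const_on_inv[OF U])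
  have ra: "rng H a \<in> arrows H" using H.rng_closed[OF a] .
  \<comment> \<open>Evaluated at a unit, convolution of diagonal elements is multiplication in the
    ring, so \<open>h (rng H a)\<close> is idempotent. The next identity excludes the value 0
    because \<open>f a\<close> is nonzero.\<close>
  have "h (rng H a) * h (rng H a) = h (rng H a)"
    using H.diagonal_convolution[OF hD ra, of h] hh a by (simp add: H.rng_rng)
  moreover have "h (rng H a) * f a = f a"
    using H.diagonal_convolution[OF hD a, of f] hf by simp
  ultimately have 1: "h (rng H a) = 1"
    using indecomposable nz unfolding indecomposable_ring_def f_def by force
  have "convolution H f g (gmult H a (ginv H a)) = f a * g (ginv H a)"
    by (rule H.convolution_composable)
      (use T_const_on_rng_cong[OF U nz _ a] a in
        \<open>auto simp: f_def H.composable_iff H.inv_closed H.rng_inv\<close>)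
  then show ?thesis using fg 1 unfolding f_def g_def by (simp add: rng_def)
qed

text \<open>Apply \<open>T\<close> to the factorization of \<open>const_on V r\<close> into a
  diagonal element and \<open>const_on U 1\<close>; the image of the first factor is again diagonal
  and acts along \<open>rng\<close>.\<close>

lemma T_const_on_subset:
  assumes U: "compact_open_bisection G U" and V: "compact_open_bisection G V" "V \<subseteq> U"
    and a: "a \<in> arrows H"
  shows "T (const_on V r) a = T (const_on (rng G ` V) r) (rng H a) * T (const_on U 1) a"
proof -
  note rngV = G.compact_open_bisection_rng[OF V(1)]
  have D: "const_on (rng G ` V) r \<in> diagonal G"
    using G.compact_open_bisection_arrows[OF V(1)] G.rng_units
    by (intro G.const_on_diagonal rngV) blast
  have "T (const_on V r) = convolution H (T (const_on (rng G ` V) r)) (T (const_on U 1))"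
    using G.convolution_rng_const_on[OF U V(2), of r]
      T_convolution[OF const_on_steinberg[OF rngV] const_on_steinberg[OF U]] by metis
  then show ?thesis using H.diagonal_convolution[OF T_diagonal[OF D] a] by simp
qed

text \<open>Besides monotonicity of supports, the case \<open>V = U\<close> shows that changing the
  coefficient from 1 to \<open>r\<close> cannot enlarge the support of the image.\<close>

lemma T_const_on_subset_nonzero:
  assumes "compact_open_bisection G U" "compact_open_bisection G V" "V \<subseteq> U" "a \<in> arrows H"
    "T (const_on V r) a \<noteq> 0"
  shows "T (const_on U 1) a \<noteq> 0"
  using T_const_on_subset[OF assms(1-4), of r] assms(5) by auto

text \<open>
  If \<open>T 1\<^bsub>U\<^esub>\<close> and \<open>T 1\<^bsub>V\<^esub>\<close> were both nonzero at \<open>a\<close>, the image of \<open>k = 1\<^bsub>U\<^esub> * 1\<^bsub>W\<^esub>\<close>, \<open>W = V\<^sup>-\<^sup>1\<close>,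
  would be nonzero at the unit \<open>rng a\<close>. As \<open>T k\<close> is supported in a bisection, cutting it down to its
  values on the units yields a diagonal element; its preimage is diagonal too, although \<open>k\<close>
  vanishes on all units.
\<close>

lemma T_const_on_disjoint:
  assumes U: "compact_open_bisection G U" and V: "compact_open_bisection G V"
    and disj: "U \<inter> V = {}" and a: "a \<in> arrows H"
  shows "T (const_on U 1) a = 0 \<or> T (const_on V 1) a = 0"
proof (rule ccontr)
  assume "\<not> ?thesis"
  then have nz: "T (const_on U 1) a \<noteq> 0" "T (const_on V 1) a \<noteq> 0" by auto
  note V' = G.compact_open_bisection_inv[OF V]
  define Z where "Z = set_mult G U (ginv G ` V)"
  have Z: "compact_open_bisection G Z"
    unfolding Z_def by (rule G.compact_open_bisection_mult[OF U V'])
  define k where "k = T (const_on Z 1)"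
  have kA: "k \<in> steinberg_algebra H" unfolding k_def by (intro T_closed const_on_steinberg Z)
  have Z_units: "z \<notin> units G" if z: "z \<in> Z" for z
  proof
    assume zu: "z \<in> units G"
    obtain u v where uv: "u \<in> U" "v \<in> V" "(u, ginv G v) \<in> composable G" "z = gmult G u (ginv G v)"
      using z unfolding Z_def set_mult_def by blast
    have "u = v"
      using G.mult_eq_unit[OF uv(3)] uv(2,4) zu G.compact_open_bisection_arrows[OF V] by blast
    then show False using uv disj by blast
  qed
  have "convolution G (const_on U 1) (const_on (ginv G ` V) 1) = const_on Z (1::'r)"
    using G.convolution_const_on[of U "ginv G ` V" 1 1] U G.compact_open_bisection_arrows[OF V']
    unfolding Z_def compact_open_bisection_def by simp
  then have "k = convolution H (T (const_on U 1)) (T (const_on (ginv G ` V) 1))"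
    unfolding k_def using T_convolution[OF const_on_steinberg[OF U] const_on_steinberg[OF V']] by metis
  moreover have "convolution H (T (const_on U 1)) (T (const_on (ginv G ` V) 1)) (gmult H a (ginv H a))
      = T (const_on U 1) a * T (const_on (ginv G ` V) 1) (ginv H a)"
    by (rule H.convolution_composable)
      (use T_const_on_rng_cong[OF U nz(1) _ a] a in
        \<open>auto simp: H.composable_iff H.inv_closed H.rng_inv\<close>)
  ultimately have k_eq: "k (rng H a) = T (const_on U 1) a * T (const_on (ginv G ` V) 1) (ginv H a)"
    by (simp add: rng_def)
  have unit: "T (const_on V 1) a * T (const_on (ginv G ` V) 1) (ginv H a) = 1"
    by (rule T_const_on_unit[OF V a nz(2)])
  \<comment> \<open>Multiplying by the unit \<open>T (const_on V 1) a\<close> recovers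
    \<open>T (const_on U 1) a\<close>, so \<open>k\<close> cannot vanish at
    \<open>rng H a\<close>.\<close>
  have "k (rng H a) * T (const_on V 1) a
      = T (const_on U 1) a * (T (const_on V 1) a * T (const_on (ginv G ` V) 1) (ginv H a))"
    unfolding k_eq by (simp only: ac_simps)
  then have "k (rng H a) * T (const_on V 1) a = T (const_on U 1) a" by (simp only: unit mult_1_right)
  then have k_nz: "k (rng H a) \<noteq> 0" using nz(1) by auto
  define W where "W = {x \<in> arrows H. k x \<noteq> 0} \<inter> units H"
  have W: "compact_open_bisection H W"
    unfolding compact_open_bisection_def W_def
    using compact_Int_closedin[OF H.compactin_steinberg_support[OF kA] H.closedin_units]
      H.openin_steinberg_vimage[OF kA, of "\<lambda>y. y \<noteq> 0"] H.openin_units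
    by (auto intro: H.bisection_units)
  have "const_on W 1 \<in> diagonal H" by (rule H.const_on_diagonal[OF W]) (simp add: W_def)
  then obtain p where p: "p \<in> diagonal G" "T p = const_on W 1" by (rule T_diagonal_surj)
  have pA: "p \<in> steinberg_algebra G" using p(1) by (simp add: G.diagonal_iff)
  define q where "q = convolution G p (const_on Z 1)"
  have qA: "q \<in> steinberg_algebra G"
    unfolding q_def by (intro G.convolution_steinberg pA const_on_steinberg Z)
  have Tq: "T q x = const_on W 1 (rng H x) * k x" if "x \<in> arrows H" for x
    using H.diagonal_convolution[OF T_diagonal[OF p(1)] that, of k]
      T_convolution[OF pA const_on_steinberg[OF Z]]
    unfolding q_def k_def p(2) by simp
  \<comment> \<open>Where \<open>T q\<close> is nonzero, both \<open>x\<close> and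
    \<open>rng H x\<close> lie in the support of \<open>k\<close>. They have the same range and this
    support is a bisection, so they coincide.\<close>
  have "x \<in> units H" if x: "x \<in> arrows H" "T q x \<noteq> 0" for x
  proof -
    have "rng H x \<in> W" and kx: "k x \<noteq> 0" using x Tq by (auto simp: const_on_def split: if_splits)
    then have "k (rng H x) \<noteq> 0" by (simp add: W_def)
    then have "x = rng H x"
      using T_const_on_rng_cong[OF Z, of "rng H x" x] kx x(1) H.rng_closed[OF x(1)] H.rng_rng[OF x(1)]
      unfolding k_def by metis
    then show ?thesis using H.rng_units[OF x(1)] by simp
  qed
  then have "T q \<in> diagonal H" using T_closed[OF qA] by (simp add: H.diagonal_iff)
  then have qD: "q \<in> diagonal G" using T_diagonal_iff[OF qA] by simp
  have "q = 0"
  proof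
    fix x
    show "q x = 0 x"
    proof (rule ccontr)
      assume nz': "q x \<noteq> 0 x"
      then have x: "x \<in> arrows G" using G.steinberg_outside[OF qA] by auto
      then have "x \<in> units G" using qD nz' by (simp add: G.diagonal_iff)
      moreover have "const_on Z (1::'r) x \<noteq> 0"
        using nz' G.diagonal_convolution[OF p(1) x, of "const_on Z 1"] unfolding q_def by auto
      ultimately show False using Z_units by (auto simp: const_on_def split: if_splits)
    qed
  qed
  then have "T q (rng H a) = 0" by (simp add: T_zero)
  moreover have "rng H a \<in> W" using k_nz a by (simp add: W_def H.rng_closed H.rng_units)
  ultimately show False
    using Tq[OF H.rng_closed[OF a]] k_nz a by (simp add: H.rng_rng const_on_def)
qed

section \<open>From points of \<open>G\<close> to points of \<open>H\<close>\<close>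

lemma T_const_on_common_nonzero:
  assumes b: "b \<in> arrows G"
  obtains a where "a \<in> arrows H"
    "\<And>V. compact_open_bisection G V \<Longrightarrow> b \<in> V \<Longrightarrow> T (const_on V 1) a \<noteq> 0"
proof -
  define N where "N = {V. compact_open_bisection G V \<and> b \<in> V}"
  define s where "s V = {x \<in> arrows H. T (const_on V 1) x \<noteq> 0}" for V
  obtain V0 where V0: "V0 \<in> N"
    using G.compact_open_bisection_ex[OF b] unfolding N_def by blast
  have A: "T (const_on V 1) \<in> steinberg_algebra H" if "V \<in> N" for V
    using that unfolding N_def by (auto intro: T_closed const_on_steinberg)
  \<comment> \<open>Finitely many neighbourhoods of \<open>b\<close> contain a common smaller one,
    \<open>W\<close>. The image of \<open>const_on W 1\<close> is nonzero because \<open>T\<close>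
    is injective, and its support lies in all the others.\<close>
  have fip: "s V0 \<inter> \<Inter>(s ` F) \<noteq> {}" if F: "finite F" "F \<subseteq> N" for F
  proof -
    have "\<exists>W\<in>N. W \<subseteq> V0 \<and> (\<forall>V\<in>F. W \<subseteq> V)"
      using F
    proof (induction rule: finite_induct)
      case empty
      then show ?case using V0 by auto
    next
      case (insert V F)
      then obtain W where "W \<in> N" "W \<subseteq> V0" "\<forall>V\<in>F. W \<subseteq> V" by auto
      moreover have "V \<in> N" using insert.prems by blast
      ultimately show ?case
        using G.compact_open_bisection_Int by (intro bexI[of _ "V \<inter> W"]) (auto simp: N_def)
    qed
    then obtain W where W: "W \<in> N" "W \<subseteq> V0" "\<forall>V\<in>F. W \<subseteq> V" by blast
    have "T (const_on W 1) \<noteq> 0"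
    proof
      assume "T (const_on W 1) = 0"
      then have "const_on W (1::'r) = 0"
        using T_inj[OF const_on_steinberg zero_steinberg] T_zero W(1) by (auto simp: N_def)
      then have "const_on W (1::'r) b = 0" by simp
      then show False using W(1) by (simp add: const_on_def N_def)
    qed
    then obtain x where x: "T (const_on W 1) x \<noteq> 0" by (auto simp: fun_eq_iff)
    then have xa: "x \<in> arrows H" using H.steinberg_outside[OF A[OF W(1)]] by blast
    have "x \<in> s V" if "V \<in> N" "W \<subseteq> V" for V
      using T_const_on_subset_nonzero[of V W x 1] that W(1) x xa unfolding s_def N_def by blast
    then show ?thesis using W F V0 by blast
  qed
  have "compactin (gtop H) (s V0)"
    unfolding s_def by (rule H.compactin_steinberg_support[OF A[OF V0]])
  moreover have "\<forall>C\<in>s ` N. closedin (gtop H) C"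
    using H.closedin_steinberg_support A unfolding s_def by blast
  moreover have "\<forall>\<F>. finite \<F> \<and> \<F> \<subseteq> s ` N \<longrightarrow> s V0 \<inter> \<Inter>\<F> \<noteq> {}"
    using fip finite_subset_image by metis
  ultimately have "s V0 \<inter> \<Inter>(s ` N) \<noteq> {}"
    unfolding compactin_fip by blast
  then obtain a where "a \<in> s V0" "a \<in> \<Inter>(s ` N)" by blast
  then show thesis using that unfolding s_def N_def by blast
qed

text \<open>At the common point \<open>a\<close> of the supports, generators living away from
  \<open>b\<close> have vanishing image. Hence \<open>T f a\<close> does not change when
  \<open>f\<close> is replaced by \<open>const_on V (f b)\<close> for a fixed neighbourhood
  \<open>V\<close> of \<open>b\<close>.\<close>

lemma T_evaluation:
  assumes b: "b \<in> arrows G"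
  obtains a where "a \<in> arrows H" "\<And>f. f \<in> steinberg_algebra G \<Longrightarrow> f b = 0 \<Longrightarrow> T f a = 0"
proof -
  obtain a where a: "a \<in> arrows H"
    and nz: "\<And>V. compact_open_bisection G V \<Longrightarrow> b \<in> V \<Longrightarrow> T (const_on V 1) a \<noteq> 0"
    by (rule T_const_on_common_nonzero[OF b]) blast
  obtain V where V: "compact_open_bisection G V" "b \<in> V"
    using G.compact_open_bisection_ex[OF b] .
  \<comment> \<open>The set \<open>V - U\<close> is a neighbourhood of \<open>b\<close> disjoint
    from \<open>U\<close>, and its image is nonzero at \<open>a\<close>.\<close>
  have away: "T (const_on U r) a = 0" if U: "compact_open_bisection G U" "b \<notin> U" for U r
  proof -
    have "T (const_on U 1) a = 0 \<or> T (const_on (V - U) 1) a = 0"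
      using G.compact_open_bisection_Diff[OF V(1) U(1)] by (intro T_const_on_disjoint U a) auto
    then have "T (const_on U 1) a = 0"
      using nz[OF G.compact_open_bisection_Diff[OF V(1) U(1)]] V(2) U(2) by blast
    then show ?thesis using T_const_on_subset_nonzero[OF U(1) U(1) order_refl a] by blast
  qed
  have "T f a = T (const_on V (f b)) a" if "f \<in> steinberg_algebra G" for f
    using that
  proof (induction rule: steinberg_induct)
    case zero
    show ?case by (simp only: zero_fun_apply const_on_zero)
  next
    case (add r U g)
    \<comment> \<open>The part of \<open>W\<close> outside \<open>U \<inter> V\<close> misses
      \<open>b\<close>, so it contributes nothing at \<open>a\<close>; this allows \<open>U\<close>
      to be replaced by \<open>V\<close>.\<close>
    have split: "T (const_on W r) a = T (const_on (U \<inter> V) r) a"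
      if W: "W \<in> {U, V}" "b \<in> U" for W
    proof -
      have mem: "compact_open_bisection G (U \<inter> V)" "compact_open_bisection G (W - U \<inter> V)"
        using W add(1) V(1) G.compact_open_bisection_Int G.compact_open_bisection_Diff by auto
      have "T (const_on W r) = T (const_on (U \<inter> V) r) + T (const_on (W - U \<inter> V) r)"
        using const_on_diff[of "U \<inter> V" W r] W(1)
          T_add[OF const_on_steinberg[OF mem(1)] const_on_steinberg[OF mem(2)]] by auto
      then show ?thesis using away[OF mem(2)] W(2) V(2) by simp
    qed
    have "T (const_on U r) a = T (const_on V (const_on U r b)) a"
    proof (cases "b \<in> U")
      case True
      then show ?thesis using split[of U] split[of V] by (simp add: const_on_def)
    next
      case False
      then show ?thesis
        using away[OF add(1)] by (simp add: const_on_def const_on_zero T_zero)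
    qed
    then have "T (const_on U r + g) a = T (const_on V (const_on U r b)) a + T (const_on V (g b)) a"
      using T_add[OF const_on_steinberg[OF add(1)] add(2)] add(3) by simp
    also have "\<dots> = T (const_on V ((const_on U r + g) b)) a"
      using T_add[OF const_on_steinberg[OF V(1)] const_on_steinberg[OF V(1)]]
      by (simp add: const_on_add[symmetric])
    finally show ?case .
  qed
  then have "T f a = 0" if "f \<in> steinberg_algebra G" "f b = 0" for f
    using that by (simp add: const_on_zero T_zero)
  then show thesis using that a by blast
qed

end

section \<open>The groupoid isomorphism and the cocycle\<close>

lemma steinberg_ring_iso_inv:
  assumes G: "ample_Hausdorff_groupoid G" and iso: "steinberg_ring_iso G H T"
  shows "steinberg_ring_iso H G (inv_into (steinberg_algebra G) T)"
proof -
  interpret G: ample_Hausdorff_groupoid G by (rule G)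
  define S where "S = inv_into (steinberg_algebra G) T"
  have bij: "bij_betw T (steinberg_algebra G) (steinberg_algebra H)"
    using iso[unfolded steinberg_ring_iso_def] by (rule conjunct1)
  have S: "bij_betw S (steinberg_algebra H) (steinberg_algebra G)"
    unfolding S_def by (rule bij_betw_inv_into[OF bij])
  have TS: "T (S h) = h" if "h \<in> steinberg_algebra H" for h
    unfolding S_def by (rule bij_betw_inv_into_right[OF bij that])
  have ST: "S (T f) = f" if "f \<in> steinberg_algebra G" for f
    unfolding S_def by (rule bij_betw_inv_into_left[OF bij that])
  have "S (h + k) = S h + S k \<and> S (convolution H h k) = convolution G (S h) (S k)"
    if hk: "h \<in> steinberg_algebra H" "k \<in> steinberg_algebra H" for h k
  proof -
    have mem: "S h \<in> steinberg_algebra G" "S k \<in> steinberg_algebra G"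
      using bij_betw_apply[OF S] hk by blast+
    have "T (S h + S k) = h + k" "T (convolution G (S h) (S k)) = convolution H h k"
      using iso[unfolded steinberg_ring_iso_def, THEN conjunct2, rule_format, OF mem]
      unfolding TS[OF hk(1)] TS[OF hk(2)] by blast+
    then show ?thesis
      using ST[OF add_steinberg[OF mem]] ST[OF G.convolution_steinberg[OF mem]] by simp
  qed
  then show ?thesis unfolding steinberg_ring_iso_def S_def[symmetric] using S by blast
qed

lemma diagonal_preserving_inv:
  assumes iso: "steinberg_ring_iso G H T" and "diagonal_preserving G H T"
  shows "diagonal_preserving H G (inv_into (steinberg_algebra G) T)"
proof -
  have "inj_on T (steinberg_algebra G)"
    using iso[unfolded steinberg_ring_iso_def] bij_betw_imp_inj_on by blast
  moreover have "diagonal G \<subseteq> steinberg_algebra G" by (auto simp: diagonal_def)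
  ultimately have "inv_into (steinberg_algebra G) T ` T ` diagonal G = diagonal G"
    by (rule inv_into_image_cancel)
  then show ?thesis using assms(2) by (simp add: diagonal_preserving_def)
qed

text \<open>If \<open>a\<close> and \<open>b\<close> differ, some compact open bisection contains
  \<open>b\<close> but not \<open>a\<close>, and its characteristic function violates the
  implication.\<close>

lemma (in ample_Hausdorff_groupoid) steinberg_separate:
  assumes "b \<in> arrows G"
    and "\<And>f :: 'a \<Rightarrow> 'r::comm_ring_1. f \<in> steinberg_algebra G \<Longrightarrow> f a = 0 \<Longrightarrow> f b = 0"
  shows "a = b"
proof (rule ccontr)
  assume "a \<noteq> b"
  then obtain U where U: "compact_open_bisection G U" "b \<in> U" "a \<notin> U"
    using compact_open_bisection_separate[of "arrows G" b a] assms(1) openin_topspace[of "gtop G"]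
    unfolding topspace_arrows by blast
  then show False
    using assms(2)[OF const_on_steinberg[OF U(1), of 1]] by (simp add: const_on_def)
qed

locale diagonal_isomorphism_pair =
  diagonal_isomorphism G H T + inverse: diagonal_isomorphism H G "inv_into (steinberg_algebra G) T"
  for G :: "'g groupoid" and H :: "'h groupoid"
    and T :: "('g \<Rightarrow> 'r::comm_ring_1) \<Rightarrow> ('h \<Rightarrow> 's::comm_ring_1)"
begin

abbreviation S where "S \<equiv> inv_into (steinberg_algebra G) T"

lemma S_T: "f \<in> steinberg_algebra G \<Longrightarrow> S (T f) = f"
  by (rule bij_betw_inv_into_left[OF T_bij])

lemma T_S: "h \<in> steinberg_algebra H \<Longrightarrow> T (S h) = h"
  by (rule bij_betw_inv_into_right[OF T_bij])

section \<open>Correspondence of points\<close>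

lemma inverse_evaluation:
  assumes "a \<in> arrows H"
  obtains b where "b \<in> arrows G" "\<And>f. f \<in> steinberg_algebra G \<Longrightarrow> T f a = 0 \<Longrightarrow> f b = 0"
proof -
  obtain b where b: "b \<in> arrows G" and "\<And>h. h \<in> steinberg_algebra H \<Longrightarrow> h a = 0 \<Longrightarrow> S h b = 0"
    by (rule inverse.T_evaluation[OF assms]) blast
  then have "f b = 0" if "f \<in> steinberg_algebra G" "T f a = 0" for f
    using that T_closed S_T by metis
  then show thesis using that b by blast
qed

text \<open>The inverse of \<open>T\<close> leads from \<open>a\<close> to a point \<open>b\<close>,
  and \<open>T\<close> leads back from \<open>b\<close> to some \<open>c\<close>. Vanishing at
  \<open>a\<close> then implies vanishing at \<open>c\<close>, so \<open>c = a\<close> by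
  separation, and both implications hold between \<open>a\<close> and \<open>b\<close>.\<close>

lemma evaluation_point:
  assumes a: "a \<in> arrows H"
  obtains b where "b \<in> arrows G" "\<And>f. f \<in> steinberg_algebra G \<Longrightarrow> T f a = 0 \<longleftrightarrow> f b = 0"
proof -
  obtain b where b: "b \<in> arrows G"
    and ab: "\<And>f. f \<in> steinberg_algebra G \<Longrightarrow> T f a = 0 \<Longrightarrow> f b = 0"
    by (rule inverse_evaluation[OF a]) blast
  obtain c where c: "c \<in> arrows H"
    and bc: "\<And>f. f \<in> steinberg_algebra G \<Longrightarrow> f b = 0 \<Longrightarrow> T f c = 0"
    by (rule T_evaluation[OF b]) blast
  have "h c = 0" if h: "h \<in> steinberg_algebra H" "h a = 0" for h :: "'h \<Rightarrow> 's"
  proof -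
    obtain f where "f \<in> steinberg_algebra G" "T f = h" using h(1) by (rule T_surj)
    then show ?thesis using ab bc h(2) by blast
  qed
  then have "a = c" by (rule H.steinberg_separate[OF c])
  then show thesis using that[OF b] ab bc by blast
qed

lemma evaluation_point_inverse:
  assumes b: "b \<in> arrows G"
  obtains a where "a \<in> arrows H" "\<And>f. f \<in> steinberg_algebra G \<Longrightarrow> T f a = 0 \<longleftrightarrow> f b = 0"
proof -
  obtain a where a: "a \<in> arrows H"
    and ba: "\<And>f. f \<in> steinberg_algebra G \<Longrightarrow> f b = 0 \<Longrightarrow> T f a = 0"
    by (rule T_evaluation[OF b]) blast
  obtain c where c: "c \<in> arrows G"
    and ac: "\<And>f. f \<in> steinberg_algebra G \<Longrightarrow> T f a = 0 \<Longrightarrow> f c = 0"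
    by (rule inverse_evaluation[OF a]) blast
  have "b = c" by (rule G.steinberg_separate[OF c]) (blast intro: ba ac)
  then show thesis using that[OF a] ba ac by blast
qed

text \<open>The restriction fixes the value outside the carrier of \<open>H\<close>, so that the map
  is extensional and can be unique as a function on the whole type.\<close>

definition point :: "'h \<Rightarrow> 'g" where
  "point = restrict (\<lambda>a. SOME b. b \<in> arrows G \<and>
     (\<forall>f\<in>steinberg_algebra G. T f a = 0 \<longleftrightarrow> f b = 0)) (arrows H)"

lemma point:
  assumes "a \<in> arrows H"
  shows "point a \<in> arrows G \<and> (\<forall>f\<in>steinberg_algebra G. T f a = 0 \<longleftrightarrow> f (point a) = 0)"
proof -
  have "\<exists>b. b \<in> arrows G \<and> (\<forall>f\<in>steinberg_algebra G. T f a = 0 \<longleftrightarrow> f b = 0)"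
    by (rule evaluation_point[OF assms]) blast
  from someI_ex[OF this] show ?thesis unfolding point_def restrict_apply'[OF assms] .
qed

lemma point_arrows: "a \<in> arrows H \<Longrightarrow> point a \<in> arrows G"
  using point by blast

lemma T_eq_zero_iff:
  "a \<in> arrows H \<Longrightarrow> f \<in> steinberg_algebra G \<Longrightarrow> T f a = 0 \<longleftrightarrow> f (point a) = 0"
  using point by blast

lemma T_const_on_nonzero_iff:
  assumes "a \<in> arrows H" "compact_open_bisection G U"
  shows "T (const_on U 1) a \<noteq> 0 \<longleftrightarrow> point a \<in> U"
  using T_eq_zero_iff[OF assms(1) const_on_steinberg[OF assms(2)], of 1] by (simp add: const_on_def)

text \<open>One implication suffices: composed with the equivalence at \<open>point a\<close>, it
  says that vanishing at \<open>b\<close> implies vanishing at \<open>point a\<close>.\<close>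

lemma point_unique:
  assumes "a \<in> arrows H" "b \<in> arrows G"
    and "\<And>f. f \<in> steinberg_algebra G \<Longrightarrow> f b = 0 \<Longrightarrow> T f a = 0"
  shows "b = point a"
  by (rule G.steinberg_separate[OF point_arrows[OF assms(1)]])
    (use assms(3) T_eq_zero_iff[OF assms(1)] in blast)

lemma point_bij: "bij_betw point (arrows H) (arrows G)"
  unfolding bij_betw_def
proof
  show "inj_on point (arrows H)"
  proof (rule inj_onI)
    fix a c assume ac: "a \<in> arrows H" "c \<in> arrows H" "point a = point c"
    have "h c = 0" if h: "h \<in> steinberg_algebra H" "h a = 0" for h :: "'h \<Rightarrow> 's"
    proof -
      obtain f where f: "f \<in> steinberg_algebra G" "T f = h" using h(1) by (rule T_surj)
      have "T f a = 0" using f(2) h(2) by simp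
      then have "T f c = 0"
        using T_eq_zero_iff[OF ac(1) f(1)] T_eq_zero_iff[OF ac(2) f(1)] ac(3) by simp
      then show ?thesis using f(2) by simp
    qed
    then show "a = c" by (rule H.steinberg_separate[OF ac(2)])
  qed
  show "point ` arrows H = arrows G"
  proof
    show "point ` arrows H \<subseteq> arrows G" using point_arrows by blast
    show "arrows G \<subseteq> point ` arrows H"
    proof
      fix b assume b: "b \<in> arrows G"
      obtain a where a: "a \<in> arrows H" "\<And>f. f \<in> steinberg_algebra G \<Longrightarrow> T f a = 0 \<longleftrightarrow> f b = 0"
        by (rule evaluation_point_inverse[OF b]) blast
      then have "b = point a" by (intro point_unique[OF _ b]) blast+
      then show "b \<in> point ` arrows H" using a(1) by blast
    qed
  qed
qed

section \<open>The point map is a homeomorphism\<close>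

lemma open_nhd_point:
  assumes U: "compact_open_bisection G U"
  shows "openin (gtop H) {x \<in> arrows H. point x \<in> U}"
proof -
  have "{x \<in> arrows H. point x \<in> U} = {x \<in> arrows H. T (const_on U 1) x \<noteq> 0}"
    using T_const_on_nonzero_iff[OF _ U] by blast
  then show ?thesis
    using H.openin_steinberg_vimage[OF T_closed[OF const_on_steinberg[OF U]]] by simp
qed

lemma homeomorphic_map_point: "homeomorphic_map (gtop H) (gtop G) point"
proof (rule bijective_open_imp_homeomorphic_map)
  show "continuous_map (gtop H) (gtop G) point"
    unfolding continuous_map_def
  proof (intro conjI allI impI)
    show "point \<in> topspace (gtop H) \<rightarrow> topspace (gtop G)" using point_arrows by simp
    fix W assume W: "openin (gtop G) W"
    show "openin (gtop H) {x \<in> topspace (gtop H). point x \<in> W}"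
    proof (subst openin_subopen, intro ballI)
      fix a assume "a \<in> {x \<in> topspace (gtop H). point x \<in> W}"
      then have a: "a \<in> arrows H" "point a \<in> W" by auto
      obtain U where U: "compact_open_bisection G U" "point a \<in> U" "U \<subseteq> W"
        using G.compact_open_bisection_nhd[OF W a(2)] .
      have "{x \<in> arrows H. point x \<in> U} \<subseteq> {x \<in> topspace (gtop H). point x \<in> W}"
        using U(3) by auto
      then show "\<exists>V. openin (gtop H) V \<and> a \<in> V \<and> V \<subseteq> {x \<in> topspace (gtop H). point x \<in> W}"
        using open_nhd_point[OF U(1)] a(1) U(2) by blast
    qed
  qed
  show "open_map (gtop H) (gtop G) point"
    unfolding open_map_def
  proof (intro allI impI)
    fix W assume W: "openin (gtop H) W"
    show "openin (gtop G) (point ` W)"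
    proof (subst openin_subopen, intro ballI)
      fix b assume "b \<in> point ` W"
      then obtain a where a: "a \<in> W" "b = point a" by blast
      have aH: "a \<in> arrows H" using H.openin_arrows[OF W] a(1) by blast
      obtain Y where Y: "compact_open_bisection H Y" "a \<in> Y" "Y \<subseteq> W"
        using H.compact_open_bisection_nhd[OF W a(1)] .
      have one: "const_on Y 1 \<in> steinberg_algebra H" by (rule const_on_steinberg[OF Y(1)])
      have SY: "S (const_on Y 1) \<in> steinberg_algebra G" by (rule inverse.T_closed[OF one])
      \<comment> \<open>The preimage of \<open>const_on Y 1\<close> under \<open>T\<close> is
        nonzero exactly on the image of \<open>Y\<close> under \<open>point\<close>, so that image
        is open.\<close>
      have iff: "S (const_on Y 1) (point x) \<noteq> 0 \<longleftrightarrow> x \<in> Y" if "x \<in> arrows H" for x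
        using T_eq_zero_iff[OF that SY] unfolding T_S[OF one]
        by (auto simp: const_on_def split: if_splits)
      define V where "V = {y \<in> arrows G. S (const_on Y 1) y \<noteq> 0}"
      have "openin (gtop G) V" unfolding V_def by (rule G.openin_steinberg_vimage[OF SY])
      moreover have "b \<in> V" unfolding V_def using iff[OF aH] Y(2) a(2) point_arrows[OF aH] by simp
      moreover have "V \<subseteq> point ` W"
      proof
        fix y assume y: "y \<in> V"
        then have "y \<in> point ` arrows H"
          unfolding V_def using bij_betw_imp_surj_on[OF point_bij] by simp
        then obtain x where x: "x \<in> arrows H" "y = point x" by blast
        then have "x \<in> Y" using iff[OF x(1)] y by (simp add: V_def)
        then show "y \<in> point ` W" using x(2) Y(3) by blast
      qed
      ultimately show "\<exists>V. openin (gtop G) V \<and> b \<in> V \<and> V \<subseteq> point ` W" by blast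
    qed
  qed
  show "point ` topspace (gtop H) = topspace (gtop G)"
    using bij_betw_imp_surj_on[OF point_bij] by simp
  show "inj_on point (topspace (gtop H))"
    using bij_betw_imp_inj_on[OF point_bij] by simp
qed

section \<open>Multiplicativity of the point map\<close>

lemma T_convolution_const_on:
  assumes U: "compact_open_bisection G U" and V: "compact_open_bisection G V"
    and ab: "(a, b) \<in> composable H" and a: "point a \<in> U"
  shows "T (convolution G (const_on U r) (const_on V s)) (gmult H a b)
    = T (const_on U r) a * T (const_on V s) b"
proof -
  have aH: "a \<in> arrows H" using ab by (simp add: H.composable_iff)
  have "T (const_on U 1) a \<noteq> 0" using T_const_on_nonzero_iff[OF aH U] a by simp
  \<comment> \<open>The support of \<open>T (const_on U r)\<close> lies in that of
    \<open>T (const_on U 1)\<close>, a bisection containing \<open>a\<close>. So only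
    \<open>a\<close> contributes as first factor of the product.\<close>
  then have "c = a"
    if "c \<in> arrows H" "rng H c = rng H a" "T (const_on U r) c \<noteq> 0" for c
    using T_const_on_rng_cong[OF U _ T_const_on_subset_nonzero[OF U U order_refl that(1,3)]] that aH
    by blast
  then have "convolution H (T (const_on U r)) (T (const_on V s)) (gmult H a b)
      = T (const_on U r) a * T (const_on V s) b"
    by (rule H.convolution_composable[OF ab])
  then show ?thesis
    unfolding T_convolution[OF const_on_steinberg[OF U] const_on_steinberg[OF V]] .
qed

lemma point_mult_in_set_mult:
  assumes U: "compact_open_bisection G U" and V: "compact_open_bisection G V"
    and ab: "(a, b) \<in> composable H" and a: "point a \<in> U" and b: "point b \<in> V"
  shows "point (gmult H a b) \<in> set_mult G U V"
proof -
  have H: "a \<in> arrows H" "b \<in> arrows H" using ab by (auto simp: H.composable_iff)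
  have nz: "T (const_on U 1) a \<noteq> 0" "T (const_on V 1) b \<noteq> 0"
    using T_const_on_nonzero_iff H U V a b by blast+
  \<comment> \<open>The coefficient ring may have zero divisors; the product is nonzero because
    \<open>T (const_on V 1) b\<close> is invertible.\<close>
  have "T (const_on U 1) a * T (const_on V 1) b \<noteq> 0"
  proof
    assume "T (const_on U 1) a * T (const_on V 1) b = 0"
    then have "T (const_on U 1) a * (T (const_on V 1) b * T (const_on (ginv G ` V) 1) (ginv H b)) = 0"
      by (simp only: mult.assoc[symmetric] mult_zero_left)
    then show False using nz(1) unfolding T_const_on_unit[OF V H(2) nz(2)] by simp
  qed
  then have "T (convolution G (const_on U 1) (const_on V 1)) (gmult H a b) \<noteq> 0"
    unfolding T_convolution_const_on[OF U V ab a] .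
  moreover have "convolution G (const_on U 1) (const_on V 1) = const_on (set_mult G U V) (1 * 1 :: 'r)"
    using U by (intro G.convolution_const_on G.compact_open_bisection_arrows[OF V])
      (simp add: compact_open_bisection_def)
  ultimately have "T (const_on (set_mult G U V) 1) (gmult H a b) \<noteq> 0" by simp
  then show ?thesis
    using T_const_on_nonzero_iff[OF H.mult_closed[OF ab] G.compact_open_bisection_mult[OF U V]]
    by blast
qed

text \<open>
  In a bisection, the factors of a product are determined by the product, so shrinking \<open>U\<close> around
  \<open>point a\<close> cannot change the first factor; likewise for the second one.
\<close>

lemma point_mult:
  assumes ab: "(a, b) \<in> composable H"
  shows "(point a, point b) \<in> composable G \<and>
    point (gmult H a b) = gmult G (point a) (point b)"
proof -
  have H: "a \<in> arrows H" "b \<in> arrows H" using ab by (auto simp: H.composable_iff)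
  obtain U where U: "compact_open_bisection G U" "point a \<in> U"
    using G.compact_open_bisection_ex[OF point_arrows[OF H(1)]] .
  obtain V where V: "compact_open_bisection G V" "point b \<in> V"
    using G.compact_open_bisection_ex[OF point_arrows[OF H(2)]] .
  have bis: "bisection G U" "bisection G V" using U V by (auto simp: compact_open_bisection_def)
  have opens: "openin (gtop G) U" "openin (gtop G) V"
    using U V by (auto simp: compact_open_bisection_def)
  obtain u v where uv: "u \<in> U" "v \<in> V" "(u, v) \<in> composable G" "point (gmult H a b) = gmult G u v"
    using point_mult_in_set_mult[OF U(1) V(1) ab U(2) V(2)] unfolding set_mult_def by blast
  have "u = point a"
  proof (rule ccontr)
    assume "u \<noteq> point a"
    then obtain U' where U': "compact_open_bisection G U'" "point a \<in> U'" "U' \<subseteq> U" "u \<notin> U'"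
      using G.compact_open_bisection_separate[OF opens(1) U(2)] by blast
    obtain u' v' where uv': "u' \<in> U'" "(u', v') \<in> composable G" "point (gmult H a b) = gmult G u' v'"
      using point_mult_in_set_mult[OF U'(1) V(1) ab U'(2) V(2)] unfolding set_mult_def by blast
    have "rng G u' = rng G u"
      using G.rng_mult[OF uv(3)] G.rng_mult[OF uv'(2)] uv(4) uv'(3) by simp
    then have "u' = u" using bis(1) uv(1) uv'(1) U'(3) unfolding bisection_def inj_on_def by blast
    then show False using uv'(1) U'(4) by blast
  qed
  moreover have "v = point b"
  proof (rule ccontr)
    assume "v \<noteq> point b"
    then obtain V' where V': "compact_open_bisection G V'" "point b \<in> V'" "V' \<subseteq> V" "v \<notin> V'"
      using G.compact_open_bisection_separate[OF opens(2) V(2)] by blast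
    obtain u' v' where uv': "v' \<in> V'" "(u', v') \<in> composable G" "point (gmult H a b) = gmult G u' v'"
      using point_mult_in_set_mult[OF U(1) V'(1) ab U(2) V'(2)] unfolding set_mult_def by blast
    have "src G v' = src G v"
      using G.src_mult[OF uv(3)] G.src_mult[OF uv'(2)] uv(4) uv'(3) by simp
    then have "v' = v" using bis(2) uv(2) uv'(1) V'(3) unfolding bisection_def inj_on_def by blast
    then show False using uv'(1) V'(4) by blast
  qed
  ultimately show ?thesis using uv by blast
qed

lemma topological_groupoid_iso_point: "topological_groupoid_iso H G point"
  unfolding topological_groupoid_iso_def using homeomorphic_map_point point_mult by blast

section \<open>The cocycle\<close>

definition coefficient_map :: "'h \<Rightarrow> 'r \<Rightarrow> 's" where
  "coefficient_map a r = T (SOME f. f \<in> steinberg_algebra G \<and> f (point a) = r) a"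

text \<open>The choice in the definition is immaterial: two candidates differ by an element
  vanishing at \<open>point a\<close>, whose image vanishes at \<open>a\<close>.\<close>

lemma T_eq_coefficient_map:
  assumes a: "a \<in> arrows H" and f: "f \<in> steinberg_algebra G"
  shows "T f a = coefficient_map a (f (point a))"
proof -
  define g where "g = (SOME g. g \<in> steinberg_algebra G \<and> g (point a) = f (point a))"
  have "g \<in> steinberg_algebra G \<and> g (point a) = f (point a)"
    unfolding g_def by (rule someI[of _ f]) (simp add: f)
  then have g: "g \<in> steinberg_algebra G" "g (point a) = f (point a)" by auto
  have "T (f - g) a = 0"
    using T_eq_zero_iff[OF a diff_steinberg[OF f g(1)]] g(2) by simp
  moreover have "T f = T (f - g) + T g"
    using T_add[OF diff_steinberg[OF f g(1)] g(1)] by (simp only: diff_add_cancel)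
  ultimately show ?thesis unfolding coefficient_map_def g_def[symmetric] by simp
qed

lemma coefficient_map_const_on:
  assumes "a \<in> arrows H" "compact_open_bisection G U" "point a \<in> U"
  shows "coefficient_map a r = T (const_on U r) a"
  using T_eq_coefficient_map[OF assms(1) const_on_steinberg[OF assms(2)], of r] assms(3)
  by (simp add: const_on_def)

lemma coefficient_map_Iso_plus:
  assumes a: "a \<in> arrows H"
  shows "coefficient_map a \<in> Iso_plus"
proof -
  obtain U where U: "compact_open_bisection G U" "point a \<in> U"
    using G.compact_open_bisection_ex[OF point_arrows[OF a]] .
  note eq = coefficient_map_const_on[OF a U]
  have add: "coefficient_map a (r + s) = coefficient_map a r + coefficient_map a s" for r s
    unfolding eq const_on_add T_add[OF const_on_steinberg[OF U(1)] const_on_steinberg[OF U(1)]]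
    by simp
  have zero: "r = 0" if "coefficient_map a r = 0" for r
    using that T_eq_zero_iff[OF a const_on_steinberg[OF U(1)], of r] U(2)
    unfolding eq by (simp add: const_on_def)
  have "inj (coefficient_map a)"
  proof (rule injI)
    fix r s assume rs: "coefficient_map a r = coefficient_map a s"
    have "coefficient_map a r = coefficient_map a (r - s) + coefficient_map a s"
      using add[of "r - s" s] by simp
    then have "coefficient_map a (r - s) = 0" using rs by simp
    then show "r = s" using zero[of "r - s"] by simp
  qed
  moreover have "surj (coefficient_map a)"
    unfolding surj_def
  proof
    fix s
    obtain Y where Y: "compact_open_bisection H Y" "a \<in> Y"
      using H.compact_open_bisection_ex[OF a] .
    \<comment> \<open>Surjectivity of \<open>T\<close> provides an element whose image has the
      prescribed value \<open>s\<close> at \<open>a\<close>; its value at \<open>point a\<close> is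
      the required preimage.\<close>
    obtain f where f: "f \<in> steinberg_algebra G" "T f = const_on Y s"
      using const_on_steinberg[OF Y(1)] by (rule T_surj)
    have "s = T f a" unfolding f(2) using Y(2) by (simp add: const_on_def)
    then show "\<exists>r. s = coefficient_map a r" using T_eq_coefficient_map[OF a f(1)] by blast
  qed
  ultimately show ?thesis unfolding Iso_plus_def bij_def using add by blast
qed

lemma coefficient_map_mult:
  assumes ab: "(a, b) \<in> composable H"
  shows "coefficient_map (gmult H a b) (r * s) = coefficient_map a r * coefficient_map b s"
proof -
  have H: "a \<in> arrows H" "b \<in> arrows H" using ab by (auto simp: H.composable_iff)
  obtain U where U: "compact_open_bisection G U" "point a \<in> U"
    using G.compact_open_bisection_ex[OF point_arrows[OF H(1)]] .
  obtain V where V: "compact_open_bisection G V" "point b \<in> V"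
    using G.compact_open_bisection_ex[OF point_arrows[OF H(2)]] .
  have "convolution G (const_on U r) (const_on V s) = const_on (set_mult G U V) (r * s)"
    using U by (intro G.convolution_const_on G.compact_open_bisection_arrows[OF V(1)])
      (simp add: compact_open_bisection_def)
  moreover have "coefficient_map (gmult H a b) (r * s)
      = T (const_on (set_mult G U V) (r * s)) (gmult H a b)"
    using point_mult_in_set_mult[OF U(1) V(1) ab U(2) V(2)]
    by (intro coefficient_map_const_on H.mult_closed[OF ab] G.compact_open_bisection_mult U(1) V(1))
  ultimately show ?thesis
    using T_convolution_const_on[OF U(1) V(1) ab U(2), of r s]
    by (simp add: coefficient_map_const_on[OF H(1) U] coefficient_map_const_on[OF H(2) V])
qed

lemma continuous_coefficient_map: "continuous_map (gtop H) Iso_plus_topology coefficient_map"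
  unfolding Iso_plus_topology_def continuous_map_in_subtopology continuous_map_componentwise_UNIV
proof (intro conjI allI)
  show "coefficient_map \<in> topspace (gtop H) \<rightarrow> Iso_plus" using coefficient_map_Iso_plus by simp
  fix r
  show "continuous_map (gtop H) (discrete_topology UNIV) (\<lambda>x. coefficient_map x r)"
    unfolding continuous_map_def
  proof (intro conjI allI impI)
    fix P :: "'s set"
    show "openin (gtop H) {x \<in> topspace (gtop H). coefficient_map x r \<in> P}"
    proof (subst openin_subopen, intro ballI)
      fix a assume "a \<in> {x \<in> topspace (gtop H). coefficient_map x r \<in> P}"
      then have a: "a \<in> arrows H" "coefficient_map a r \<in> P" by auto
      obtain U where U: "compact_open_bisection G U" "point a \<in> U"
        using G.compact_open_bisection_ex[OF point_arrows[OF a(1)]] .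
      \<comment> \<open>As long as \<open>point x\<close> stays in \<open>U\<close>, the value
        \<open>coefficient_map x r\<close> is that of the single locally constant function
        \<open>T (const_on U r)\<close>.\<close>
      define W where "W = {x \<in> arrows H. point x \<in> U} \<inter> {x \<in> arrows H. T (const_on U r) x \<in> P}"
      have "openin (gtop H) W"
        unfolding W_def
        by (intro openin_Int open_nhd_point H.openin_steinberg_vimage T_closed const_on_steinberg U)
      moreover have "a \<in> W"
        unfolding W_def using a U(2) coefficient_map_const_on[OF a(1) U, of r] by simp
      moreover have "W \<subseteq> {x \<in> topspace (gtop H). coefficient_map x r \<in> P}"
        unfolding W_def using coefficient_map_const_on[OF _ U(1), of _ r] by auto
      ultimately show "\<exists>W. openin (gtop H) W \<and> a \<in> W \<and>
          W \<subseteq> {x \<in> topspace (gtop H). coefficient_map x r \<in> P}" by blast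
    qed
  qed simp
qed

lemma continuous_cocycle_coefficient_map: "continuous_cocycle H coefficient_map"
  unfolding continuous_cocycle_def
  using coefficient_map_Iso_plus coefficient_map_mult continuous_coefficient_map by blast

text \<open>Additivity gives \<open>chi a 0 = 0\<close>, so \<open>f (\<phi> a) = 0\<close> implies
  \<open>T f a = 0\<close>, and this implication characterizes \<open>point a\<close>. Uniqueness
  thus holds whichever cocycle accompanies \<open>\<phi>\<close>.\<close>

lemma point_eqI:
  assumes iso: "topological_groupoid_iso H G \<phi>" and chi: "continuous_cocycle H chi"
    and T: "\<forall>a\<in>arrows H. \<forall>f\<in>steinberg_algebra G. T f a = chi a (f (\<phi> a))"
    and a: "a \<in> arrows H"
  shows "\<phi> a = point a"
proof (rule point_unique[OF a])
  have "\<phi> ` topspace (gtop H) = topspace (gtop G)"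
    using iso unfolding topological_groupoid_iso_def
    by (blast dest: homeomorphic_imp_surjective_map)
  then show "\<phi> a \<in> arrows G" using a by auto
  have "chi a \<in> Iso_plus" using chi a unfolding continuous_cocycle_def by blast
  then have "chi a (0 + 0) = chi a 0 + chi a 0" unfolding Iso_plus_def by blast
  then have "chi a 0 = 0" by simp
  then show "T f a = 0" if "f \<in> steinberg_algebra G" "f (\<phi> a) = 0" for f
    using T a that by simp
qed

end

theorem theorem3p41:
  fixes G :: "'g groupoid" and H :: "'h groupoid"
    and T :: "('g \<Rightarrow> 'r::comm_ring_1) \<Rightarrow> ('h \<Rightarrow> 's::comm_ring_1)"
  assumes "ample_Hausdorff_groupoid G" and "ample_Hausdorff_groupoid H"
    and "indecomposable_ring TYPE('r)" and "indecomposable_ring TYPE('s)"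
    and "local_bisection_hypothesis G TYPE('r)"
    and "local_bisection_hypothesis H TYPE('s)"
    and "steinberg_ring_iso G H T"
    and "diagonal_preserving G H T"
  shows "\<exists>!\<phi>. \<phi> \<in> extensional (arrows H) \<and> topological_groupoid_iso H G \<phi> \<and>
    (\<exists>chi :: 'h \<Rightarrow> 'r \<Rightarrow> 's. continuous_cocycle H chi \<and>
       (\<forall>a \<in> arrows H. \<forall>f \<in> steinberg_algebra G. T f a = chi a (f (\<phi> a))))"
proof -
  \<comment> \<open>The assumptions on \<open>G\<close> and its coefficients enter through the
    instance for the inverse of \<open>T\<close>.\<close>
  interpret diagonal_isomorphism_pair G H T
    by (intro diagonal_isomorphism_pair.intro diagonal_isomorphism.intro
        diagonal_isomorphism_axioms.intro assms steinberg_ring_iso_inv diagonal_preserving_inv)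
  show ?thesis
  proof (rule ex1I[of _ point], intro conjI)
    show "point \<in> extensional (arrows H)" by (simp add: point_def)
    show "topological_groupoid_iso H G point" by (rule topological_groupoid_iso_point)
    show "\<exists>chi. continuous_cocycle H chi \<and>
        (\<forall>a \<in> arrows H. \<forall>f \<in> steinberg_algebra G. T f a = chi a (f (point a)))"
      using continuous_cocycle_coefficient_map T_eq_coefficient_map by blast
  next
    fix \<phi>
    assume \<phi>: "\<phi> \<in> extensional (arrows H) \<and> topological_groupoid_iso H G \<phi> \<and>
      (\<exists>chi :: 'h \<Rightarrow> 'r \<Rightarrow> 's. continuous_cocycle H chi \<and>
         (\<forall>a \<in> arrows H. \<forall>f \<in> steinberg_algebra G. T f a = chi a (f (\<phi> a))))"
    then show "\<phi> = point"
      using point_eqI by (intro extensionalityI[of _ "arrows H"]) (auto simp: point_def)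
  qed
qed

end
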